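(* There is an absolute constant $c>0$ such that for every fixed constant $\lambda>0$ there exists an explicit infinite family of $\left(1-\lambda-o_n(1),\ \tfrac12-c\lambda\right)$-dimension expanders $(\mathbb{C}^n,\{T_i\}_{i\in[d]})$ over $\mathbb{C}$, with $n\to\infty$ along the family and with the number $d$ of maps bounded by a constant depending only on $\lambda$.
   Context: Let $\mathbb{F}$ be a field, $V$ an $n$-dimensional $\mathbb{F}$-vector space and $T_1,\dots,T_d:V\to V$ linear maps. $(V,\{T_i\}_{i\in[d]})$ is an $(\epsilon,\gamma)$-dimension expander if for every subspace $W\subseteq V$ of dimension at most $\gamma n$, $\dim\left(W+\sum_{i=1}^dT_i(W)\right)\ge(1+\epsilon)\dim(W)$. Here $o_n(1)$ denotes a quantity tending to $0$ as $n\to\infty$ (for fixed $\lambda$). Explicit: the maps can be computed deterministically in time $\mathrm{poly}(n)$ for fixed $\lambda$. *)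

theory Defs
  imports
    Complex_Main
    "HOL-Computational_Algebra.Polynomial"
    "Jordan_Normal_Form.Matrix"
    "Jordan_Normal_Form.VS_Connect"
begin

section \<open>Dimension expanders\<close>

text \<open>The set whose dimension is taken on the left of the last inequality is the sum of
  subspaces \<open>W + T 0 (W) + ... + T (d - 1) (W)\<close>. The maps are indexed by \<open>{..<d}\<close>.\<close>

definition (in vectorspace) dimension_expander ::
    "nat \<Rightarrow> (nat \<Rightarrow> 'c \<Rightarrow> 'c) \<Rightarrow> real \<Rightarrow> real \<Rightarrow> bool" where
  "dimension_expander d T \<epsilon> \<gamma> \<longleftrightarrow>
     fin_dim \<and> (\<forall>i<d. linear_map K V V (T i)) \<and>
     (\<forall>W. subspace K W V \<and> real (vectorspace.dim K (vs W)) \<le> \<gamma> * real dim \<longrightarrow>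
        real (vectorspace.dim K
          (vs {w \<oplus>\<^bsub>V\<^esub> (\<Oplus>\<^bsub>V\<^esub>i\<in>{..<d}. T i (u i)) | w u. w \<in> W \<and> (\<forall>i<d. u i \<in> W)}))
        \<ge> (1 + \<epsilon>) * real (vectorspace.dim K (vs W)))"


section \<open>Deterministic computations with a time count\<close>

text \<open>The machine model is a multi-stack machine over a fixed finite alphabet with a
  structured program. A program mentions finitely many stacks and each elementary step
  (a push, a pop, or a test of the top symbol) costs one unit. Two stacks simulate a
  Turing machine tape and vice versa with constant overhead per step, so polynomial time here
  is polynomial time on deterministic multi-tape Turing machines. A test may depend on the
  top symbol (\<open>None\<close> if the stack is empty), of which there are only five possible values,
  so a test predicate is a finite table.\<close>

datatype sym = Zero | One | Minus | Sep

type_synonym stacks = "nat \<Rightarrow> sym list"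

definition top_sym :: "sym list \<Rightarrow> sym option" where
  "top_sym xs = (case xs of [] \<Rightarrow> None | x # _ \<Rightarrow> Some x)"

datatype prog =
    Skip
  | Push nat sym
  | Pop nat
  | Seq prog prog
  | Cond nat "sym option \<Rightarrow> bool" prog prog
  | Loop nat "sym option \<Rightarrow> bool" prog

text \<open>\<open>runs P s t s'\<close>: started on \<open>s\<close>, the program \<open>P\<close> halts with stacks \<open>s'\<close> after
  \<open>t\<close> steps.\<close>

inductive runs :: "prog \<Rightarrow> stacks \<Rightarrow> nat \<Rightarrow> stacks \<Rightarrow> bool" where
  runs_Skip: "runs Skip s 1 s"
| runs_Push: "runs (Push r a) s 1 (s(r := a # s r))"
| runs_Pop: "runs (Pop r) s 1 (s(r := tl (s r)))"
| runs_Seq: "runs P s t s' \<Longrightarrow> runs Q s' t' s'' \<Longrightarrow> runs (Seq P Q) s (t + t') s''"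
| runs_CondT: "b (top_sym (s r)) \<Longrightarrow> runs P s t s' \<Longrightarrow> runs (Cond r b P Q) s (1 + t) s'"
| runs_CondF: "\<not> b (top_sym (s r)) \<Longrightarrow> runs Q s t s' \<Longrightarrow> runs (Cond r b P Q) s (1 + t) s'"
| runs_LoopF: "\<not> b (top_sym (s r)) \<Longrightarrow> runs (Loop r b P) s 1 s"
| runs_LoopT: "b (top_sym (s r)) \<Longrightarrow> runs P s t s' \<Longrightarrow> runs (Loop r b P) s' t' s'' \<Longrightarrow>
    runs (Loop r b P) s (1 + t + t') s''"

lemma runs_deterministic:
  "runs P s t s' \<Longrightarrow> runs P s u s'' \<Longrightarrow> u = t \<and> s'' = s'"
proof (induction arbitrary: u s'' rule: runs.induct)
  case (runs_Skip s)
  from runs_Skip.prems show ?case by cases auto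
next
  case (runs_Push r a s)
  from runs_Push.prems show ?case by cases auto
next
  case (runs_Pop r s)
  from runs_Pop.prems show ?case by cases auto
next
  case (runs_Seq P s t s' Q t' s3)
  from runs_Seq.prems runs_Seq.IH show ?case by cases blast
next
  case (runs_CondT b s r P t s' Q)
  from runs_CondT.prems runs_CondT.IH runs_CondT.hyps show ?case by cases blast+
next
  case (runs_CondF b s r Q t s' P)
  from runs_CondF.prems runs_CondF.IH runs_CondF.hyps show ?case by cases blast+
next
  case (runs_LoopF b s r P)
  from runs_LoopF.prems runs_LoopF.hyps show ?case by cases blast+
next
  case (runs_LoopT b s r P t s' t' s3)
  from runs_LoopT.prems runs_LoopT.IH runs_LoopT.hyps show ?case by cases blast+
qed

text \<open>The input is a number in unary on stack 0; the output is read off stack 1, top first.\<close>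

definition unary_input :: "nat \<Rightarrow> stacks" where
  "unary_input k = (\<lambda>r. if r = 0 then replicate k One else [])"

definition computes_in :: "prog \<Rightarrow> nat \<Rightarrow> sym list \<Rightarrow> nat \<Rightarrow> bool" where
  "computes_in P k w t \<longleftrightarrow> (\<exists>s. runs P (unary_input k) t s \<and> s 1 = w)"


section \<open>Exact encoding of complex matrices by words\<close>

text \<open>Binary, least significant digit first.\<close>

fun nat_word :: "nat \<Rightarrow> sym list" where
  "nat_word 0 = []"
| "nat_word (Suc m) = (if odd (Suc m) then One else Zero) # nat_word (Suc m div 2)"

definition int_word :: "int \<Rightarrow> sym list" where
  "int_word x = (if x < 0 then [Minus] else []) @ nat_word (nat \<bar>x\<bar>) @ [Sep]"

text \<open>An algebraic number is given exactly by a nonzero integer polynomial together with a disc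
  with centre \<open>(u + v \<i>) / q\<close> and radius \<open>r / q\<close> in which it is the only root. A number has many
  codes, but a code determines its number.\<close>

definition algebraic_code :: "int list \<Rightarrow> complex \<Rightarrow> bool" where
  "algebraic_code xs z \<longleftrightarrow>
     (\<exists>(p :: int poly) u v r q :: int.
        p \<noteq> 0 \<and> q > 0 \<and> xs = int (degree p) # coeffs p @ [u, v, r, q] \<and>
        {y. poly (map_poly of_int p) y = 0 \<and>
            cmod (y - Complex (real_of_int u / real_of_int q) (real_of_int v / real_of_int q))
              < real_of_int r / real_of_int q} = {z})"

text \<open>The code lists \<open>n\<close>, \<open>d\<close> and then the entries of the \<open>d\<close> matrices, row by row.\<close>

definition matrices_code :: "nat \<Rightarrow> nat \<Rightarrow> (nat \<Rightarrow> complex mat) \<Rightarrow> sym list \<Rightarrow> bool" where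
  "matrices_code n d T w \<longleftrightarrow>
     (\<exists>e. (\<forall>i<d. \<forall>a<n. \<forall>b<n. algebraic_code (e i a b) (T i $$ (a, b))) \<and>
          w = concat (map int_word ([int n, int d] @
                concat [e i a b. i \<leftarrow> [0..<d], a \<leftarrow> [0..<n], b \<leftarrow> [0..<n]])))"

text \<open>One program produces, from the index \<open>k\<close>, the whole \<open>k\<close>-th tuple of matrices in time
  polynomial in its dimension \<open>N k\<close> (not merely a single entry on demand).\<close>

definition explicit_family ::
    "(nat \<Rightarrow> nat) \<Rightarrow> (nat \<Rightarrow> nat) \<Rightarrow> (nat \<Rightarrow> nat \<Rightarrow> complex mat) \<Rightarrow> bool" where
  "explicit_family N d T \<longleftrightarrow>
     (\<exists>P (p :: nat poly). \<forall>k. \<exists>w t.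
        computes_in P k w t \<and> t \<le> poly p (N k) \<and> matrices_code (N k) (d k) (T k) w)"

end

theory Submission
  imports Defs "Jordan_Normal_Form.Gram_Schmidt" "HOL-Analysis.L2_Norm"
begin

text \<open>
  Let \<open>U\<^sub>1, ..., U\<^sub>m\<close> be unitary \<open>n \<times> n\<close> matrices such that the averaged conjugation
  \<open>X \<mapsto> (\<Sum>i. U\<^sub>i\<^sup>* X U\<^sub>i) / m\<close> multiplies the squared Frobenius norm of traceless
  matrices by at most \<open>\<nu>\<close>. If \<open>W\<close> has dimension \<open>r\<close> and \<open>W'\<close>, of dimension \<open>r'\<close>, contains all
  \<open>U\<^sub>i W\<close>, then pairing the averaged conjugates of the projection onto \<open>W'\<close> with the projection onto
  \<open>W\<close> gives the value \<open>r\<close>; removing the trace part and using Cauchy-Schwarz, one obtains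
  \<open>r (n - r') \<le> \<nu> r' n\<close>. For \<open>r \<le> n / 2\<close> and small \<open>\<nu>\<close> this makes \<open>r'\<close> almost \<open>2 r\<close>. A fixed gap is
  amplified by passing to all words of a fixed length in the generators.

  The generators act on functions on \<open>k\<close>-tuples of vectors of the plane over the field with two
  elements: a map of order 3 applied to every vector, a shear coupling neighbouring vectors, a
  sign given by the first bit, and a flip of the last bit. In the basis of Pauli matrices,
  conjugation permutes the basis up to signs, and a nonzero label can be pushed to the
  boundary by the two linear maps, where a sign detects it; this is an ultrametric version of the
  argument of Margulis and of Gabber and Galil. All matrices have entries \<open>0\<close>, \<open>1\<close>, \<open>-1\<close>.
\<close>

section \<open>Words over the plane over the field with two elements\<close>

text \<open>The gap needs a constant that does not depend on \<open>k\<close>. It comes from a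
  conflict between thirds: \<open>rot\<close> cycles the three nonzero vectors, so an almost
  invariant function gives each value of the decisive block about the same mass, while away from the
  boundary a shear sends two of the values into the third. The position of the decisive block never
  enters the estimate, and so neither does \<open>k\<close>. All generators are signed permutations,
  so conjugation never mixes diagonal and off-diagonal entries, and the gap splits into two
  independent estimates. Off the diagonal the label is the sum of the two indices; on the diagonal
  it is a Walsh frequency, on which the transposed maps act. The sign generator is trivial on the
  diagonal, where each sign occurs squared; the flip takes its place. The only label left over is
  the zero frequency, that is, the trace.\<close>

text \<open>A symbol stands for a vector \<open>(x, y)\<close> over the field with two elements:
  \<open>Zero = (0, 0)\<close>, \<open>One = (1, 0)\<close>, \<open>Minus = (0, 1)\<close>, \<open>Sep = (1, 1)\<close>. The map \<open>rot\<close> is the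
  linear map \<open>(x, y) \<mapsto> (y, x + y)\<close>; its matrix is symmetric.\<close>

definition xbit :: "sym \<Rightarrow> bool" where "xbit c \<longleftrightarrow> c = One \<or> c = Sep"
definition ybit :: "sym \<Rightarrow> bool" where "ybit c \<longleftrightarrow> c = Minus \<or> c = Sep"

fun rot :: "sym \<Rightarrow> sym" where
  "rot Zero = Zero" | "rot One = Minus" | "rot Minus = Sep" | "rot Sep = One"

fun xflip :: "sym \<Rightarrow> sym" where
  "xflip Zero = One" | "xflip One = Zero" | "xflip Minus = Sep" | "xflip Sep = Minus"

fun yflip :: "sym \<Rightarrow> sym" where
  "yflip Zero = Minus" | "yflip One = Sep" | "yflip Minus = Zero" | "yflip Sep = One"

definition sym_add :: "sym \<Rightarrow> sym \<Rightarrow> sym" where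
  "sym_add c d = (if xbit d then xflip else id) ((if ybit d then yflip else id) c)"

lemma UNIV_sym: "UNIV = {Zero, One, Minus, Sep}"
  by (auto intro: sym.exhaust)

lemma finite_sym [simp]: "finite (A :: sym set)"
proof (rule finite_subset)
  show "A \<subseteq> UNIV" by simp
  show "finite (UNIV :: sym set)" unfolding UNIV_sym by simp
qed

lemma sum_sym: "(\<Sum>c\<in>UNIV. f c) = f Zero + f One + f Minus + f Sep"
  by (simp add: UNIV_sym add.assoc)

text \<open>Both maps are linear: \<open>shear\<close> adds the \<open>x\<close>-bit of each block to the \<open>y\<close>-bit of the block
  before it, and \<open>coshear False\<close> is its transpose, the argument \<open>p\<close> being the \<open>y\<close>-bit of the
  block just passed.\<close>

fun shear :: "sym list \<Rightarrow> sym list" where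
  "shear [] = []"
| "shear (c # l) = (if l \<noteq> [] \<and> xbit (hd l) then yflip c else c) # shear l"

fun coshear :: "bool \<Rightarrow> sym list \<Rightarrow> sym list" where
  "coshear p [] = []"
| "coshear p (c # l) = (if p then xflip c else c) # coshear (ybit c) l"

fun bump :: "sym list \<Rightarrow> sym list" where
  "bump [] = []"
| "bump [c] = [yflip c]"
| "bump (c # d # l) = c # bump (d # l)"

lemma length_shear [simp]: "length (shear l) = length l"
  by (induction l) auto

lemma length_coshear [simp]: "length (coshear p l) = length l"
  by (induction l arbitrary: p) auto

lemma length_bump [simp]: "length (bump l) = length l"
  by (induction l rule: bump.induct) auto

lemma rot_inj [simp]: "rot c = rot d \<longleftrightarrow> c = d"
  by (cases c; cases d) auto

lemma xflip_inj [simp]: "xflip c = xflip d \<longleftrightarrow> c = d"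
  by (cases c; cases d) auto

lemma yflip_inj [simp]: "yflip c = yflip d \<longleftrightarrow> c = d"
  by (cases c; cases d) auto

lemma yflip_neq [simp]: "yflip c \<noteq> c" "c \<noteq> yflip c"
  by (cases c; simp)+

lemma shear_inj: "shear l = shear m \<Longrightarrow> l = m"
proof (induction l arbitrary: m)
  case Nil
  then show ?case by (cases m) auto
next
  case (Cons c l)
  then obtain d m' where m: "m = d # m'" by (cases m) auto
  with Cons show ?case by (auto split: if_splits)
qed

lemma coshear_inj: "coshear p l = coshear p m \<Longrightarrow> l = m"
proof (induction l arbitrary: m p)
  case Nil
  then show ?case by (cases m) auto
next
  case (Cons c l)
  then obtain d m' where m: "m = d # m'" by (cases m) auto
  with Cons show ?case by (auto split: if_splits)
qed

lemma bump_inj: "bump l = bump m \<Longrightarrow> l = m"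
proof (induction l arbitrary: m rule: bump.induct)
  case 1
  then show ?case by (cases m rule: bump.cases) auto
next
  case (2 c)
  then show ?case by (cases m rule: bump.cases) (auto dest: arg_cong[of _ _ length])
next
  case (3 c d l)
  have "length m = length (c # d # l)" using arg_cong[OF 3(2), of length] by simp
  then obtain c' d' l' where "m = c' # d' # l'" by (cases m rule: bump.cases) auto
  with 3 show ?case by auto
qed

section \<open>The decisive block of a label and its motion\<close>

fun first_diff :: "sym list \<Rightarrow> sym list \<Rightarrow> sym" where
  "first_diff (c # l) (d # m) = (if c = d then first_diff l m else sym_add c d)"
| "first_diff _ _ = Zero"

fun last_nonzero :: "sym list \<Rightarrow> sym" where
  "last_nonzero [] = Zero"
| "last_nonzero (c # l) = (if last_nonzero l = Zero then c else last_nonzero l)"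

lemma sym_add_eq_Zero: "sym_add c d = Zero \<longleftrightarrow> c = d"
  by (cases c; cases d) (auto simp: sym_add_def xbit_def ybit_def)

lemma sym_add_rot: "sym_add (rot c) (rot d) = rot (sym_add c d)"
  by (cases c; cases d) (auto simp: sym_add_def xbit_def ybit_def)

lemma xbit_sym_add: "xbit (sym_add c d) \<longleftrightarrow> xbit c \<noteq> xbit d"
  by (cases c; cases d) (auto simp: sym_add_def xbit_def ybit_def)

lemma sym_add_yflip: "sym_add (yflip c) c = Minus" "sym_add c (yflip c) = Minus"
  by (cases c; auto simp: sym_add_def xbit_def ybit_def)+

lemma first_diff_eq_Zero: "length l = length m \<Longrightarrow> first_diff l m = Zero \<longleftrightarrow> l = m"
  by (induction l m rule: list_induct2) (auto simp: sym_add_eq_Zero)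

lemma first_diff_rot: "length l = length m \<Longrightarrow> first_diff (map rot l) (map rot m) = rot (first_diff l m)"
  by (induction l m rule: list_induct2) (auto simp: sym_add_rot)

text \<open>The first differing block acts on the block before it only through its x-bit, and there
  the two words agreed, so after the shear they differ by exactly \<open>Minus\<close>. As the first
  difference has an x-bit, equal x-bits of the heads say that it is not in the first block, where
  nothing precedes it.\<close>

lemma first_diff_shear:
  "length l = length m \<Longrightarrow> xbit (first_diff l m) \<Longrightarrow> xbit (hd l) = xbit (hd m) \<Longrightarrow>
    first_diff (shear l) (shear m) = Minus"
proof (induction l m rule: list_induct2)
  case Nil
  then show ?case by (simp add: xbit_def)
next
  case (Cons c l d m)
  from Cons.prems have [simp]: "d = c" by (auto simp: xbit_sym_add split: if_splits)
  from Cons.prems have "xbit (first_diff l m)" by simp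
  moreover from this have "l \<noteq> []" "m \<noteq> []" by (cases l; cases m; auto simp: xbit_def)+
  ultimately show ?case using Cons.IH
    by (cases "xbit (hd l)"; cases "xbit (hd m)") (auto simp: sym_add_yflip)
qed

lemma last_nonzero_eq_Zero: "last_nonzero l = Zero \<longleftrightarrow> l = replicate (length l) Zero"
  by (induction l) auto

lemma last_nonzero_rot: "last_nonzero (map rot l) = rot (last_nonzero l)"
proof -
  have "rot c = Zero \<longleftrightarrow> c = Zero" for c by (cases c) auto
  then show ?thesis by (induction l) auto
qed

lemma coshear_Zero: "coshear False (replicate n Zero) = replicate n Zero"
  by (induction n) (auto simp: ybit_def)

text \<open>The mirror image: a last nonzero block with a y-bit flips the x-bit of the zero block
  behind it, which becomes \<open>One\<close>, and everything further on stays zero. The condition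
  on \<open>last l\<close> ensures that there is a block behind. The bit \<open>p\<close> can alter
  only the first block, too early to matter.\<close>

lemma last_nonzero_coshear:
  "ybit (last_nonzero l) \<Longrightarrow> \<not> ybit (last l) \<Longrightarrow> last_nonzero (coshear p l) = One"
proof (induction l arbitrary: p)
  case Nil
  then show ?case by (simp add: ybit_def)
next
  case (Cons c l)
  from Cons.prems have l: "l \<noteq> []" by auto
  show ?case
  proof (cases "last_nonzero l = Zero")
    case True
    with Cons.prems have c: "ybit c" by simp
    from True l obtain n where "l = Zero # replicate n Zero"
      unfolding last_nonzero_eq_Zero by (cases l) auto
    moreover have "\<not> ybit Zero" by (simp add: ybit_def)
    moreover have "last_nonzero (replicate n Zero) = Zero" by (simp add: last_nonzero_eq_Zero)
    ultimately show ?thesis using c by (simp add: coshear_Zero)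
  next
    case False
    then show ?thesis using Cons.IH[of "ybit c"] Cons.prems l by simp
  qed
qed

definition words :: "nat \<Rightarrow> sym list set" where "words k = {w. length w = k}"

lemma words_0: "words 0 = {[]}"
  by (auto simp: words_def)

lemma words_Suc: "words (Suc k) = (\<lambda>(c, l). c # l) ` (UNIV \<times> words k)"
  by (auto simp: words_def length_Suc_conv image_iff)

lemma finite_words [simp]: "finite (words k)"
  by (induction k) (auto simp: words_0 words_Suc)

lemma sum_words_Suc: "(\<Sum>w\<in>words (Suc k). f w) = (\<Sum>c\<in>UNIV. \<Sum>l\<in>words k. f (c # l))"
  by (simp add: words_Suc sum.reindex inj_on_def sum.cartesian_product split_def)

lemma bij_words:
  assumes "\<And>l. length (f l) = length l" "\<And>l m. f l = f m \<Longrightarrow> l = m"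
  shows "bij_betw f (words k) (words k)"
proof -
  have inj: "inj_on f (words k)" by (simp add: inj_on_def assms)
  moreover have "f ` words k \<subseteq> words k" using assms by (auto simp: words_def)
  ultimately show ?thesis by (simp add: bij_betw_def endo_inj_surj)
qed

section \<open>A spectral gap for signed permutations\<close>

text \<open>The inequality of arithmetic and geometric means with weight 1/10. Displacements may be
  expensive, but the factor 11/10 has to stay close to 1, since it is lost at every move around the
  cycle of regions.\<close>

lemma cmod_sq_le:
  "(cmod p)\<^sup>2 \<le> 11 / 10 * (cmod q)\<^sup>2 + 11 * (cmod (q - p))\<^sup>2"
proof -
  have "cmod p \<le> cmod q + cmod (q - p)"
    by (metis norm_minus_commute norm_triangle_sub)
  then have "(cmod p)\<^sup>2 \<le> (cmod q + cmod (q - p))\<^sup>2"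
    by (intro power_mono) auto
  also have "\<dots> \<le> 11 / 10 * (cmod q)\<^sup>2 + 11 * (cmod (q - p))\<^sup>2"
    using zero_le_power2[of "cmod q - 10 * cmod (q - p)"]
    by (simp add: power2_eq_square algebra_simps)
  finally show ?thesis .
qed

lemma sum_moved_le:
  fixes f :: "'a \<Rightarrow> complex"
  assumes "finite \<Omega>" "S \<subseteq> \<Omega>" "S' \<subseteq> \<Omega>" "inj_on g \<Omega>" "g ` S \<subseteq> S'"
  shows "(\<Sum>w\<in>S. (cmod (f w))\<^sup>2) \<le>
    11 / 10 * (\<Sum>w\<in>S'. (cmod (f w))\<^sup>2) + 11 * (\<Sum>w\<in>\<Omega>. (cmod (f (g w) - f w))\<^sup>2)"
proof -
  have fin: "finite S" "finite S'" using assms finite_subset by auto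
  have inj: "inj_on g S" using assms inj_on_subset by blast
  have "(\<Sum>w\<in>S. (cmod (f w))\<^sup>2) \<le>
      11 / 10 * (\<Sum>w\<in>S. (cmod (f (g w)))\<^sup>2) + 11 * (\<Sum>w\<in>S. (cmod (f (g w) - f w))\<^sup>2)"
    unfolding sum_distrib_left sum.distrib[symmetric] by (intro sum_mono cmod_sq_le)
  also have "(\<Sum>w\<in>S. (cmod (f (g w)))\<^sup>2) = (\<Sum>w\<in>g ` S. (cmod (f w))\<^sup>2)"
    by (simp add: sum.reindex[OF inj])
  also have "\<dots> \<le> (\<Sum>w\<in>S'. (cmod (f w))\<^sup>2)"
    using fin assms by (intro sum_mono2) auto
  also have "(\<Sum>w\<in>S. (cmod (f (g w) - f w))\<^sup>2) \<le> (\<Sum>w\<in>\<Omega>. (cmod (f (g w) - f w))\<^sup>2)"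
    using assms by (intro sum_mono2) auto
  finally show ?thesis by simp
qed

text \<open>Ping-pong: \<open>\<tau>\<close> permutes the three regions cyclically, so each carries about a third of an almost
  invariant mass, while \<open>\<sigma>\<close> moves two of them (outside \<open>H\<close>) into the third.\<close>

lemma almost_invariant_mass:
  fixes f :: "'a \<Rightarrow> complex" and reg :: "'a \<Rightarrow> sym"
  assumes fin: "finite \<Omega>" and H: "H \<subseteq> \<Omega>"
    and reg: "\<And>w. w \<in> \<Omega> \<Longrightarrow> reg w \<noteq> Zero" and z: "z \<noteq> Zero"
    and \<tau>: "inj_on \<tau> \<Omega>" "\<And>w. w \<in> \<Omega> \<Longrightarrow> \<tau> w \<in> \<Omega> \<and> reg (\<tau> w) = rot (reg w)"
    and \<sigma>: "inj_on \<sigma> \<Omega>" "\<And>w. w \<in> \<Omega> \<Longrightarrow> w \<notin> H \<Longrightarrow> reg w \<noteq> z \<Longrightarrow> \<sigma> w \<in> \<Omega> \<and> reg (\<sigma> w) = z"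
  shows "(\<Sum>w\<in>\<Omega>. (cmod (f w))\<^sup>2) \<le>
    200 * ((\<Sum>w\<in>\<Omega>. (cmod (f (\<tau> w) - f w))\<^sup>2) + (\<Sum>w\<in>\<Omega>. (cmod (f (\<sigma> w) - f w))\<^sup>2)
      + (\<Sum>w\<in>H. (cmod (f w))\<^sup>2))"
proof -
  define R where "R c = {w \<in> \<Omega>. reg w = c}" for c
  define m where "m c = (\<Sum>w\<in>R c. (cmod (f w))\<^sup>2)" for c
  define e1 where "e1 = (\<Sum>w\<in>\<Omega>. (cmod (f (\<tau> w) - f w))\<^sup>2)"
  define e2 where "e2 = (\<Sum>w\<in>\<Omega>. (cmod (f (\<sigma> w) - f w))\<^sup>2)"
  define h where "h = (\<Sum>w\<in>H. (cmod (f w))\<^sup>2)"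
  have finR [simp]: "finite (R c)" for c using fin by (simp add: R_def)
  have m1: "m c \<le> 11 / 10 * m (rot c) + 11 * e1" for c
    unfolding m_def e1_def by (rule sum_moved_le) (use fin \<tau> in \<open>auto simp: R_def\<close>)
  have "(\<Sum>w\<in>\<Omega> - R z. (cmod (f w))\<^sup>2) \<le>
      (\<Sum>w\<in>(\<Omega> - R z - H) \<union> H. (cmod (f w))\<^sup>2)"
    using fin H by (intro sum_mono2) (auto intro: finite_subset)
  also have "\<dots> = (\<Sum>w\<in>\<Omega> - R z - H. (cmod (f w))\<^sup>2) + h"
    unfolding h_def using fin H by (intro sum.union_disjoint) (auto intro: finite_subset)
  also have "(\<Sum>w\<in>\<Omega> - R z - H. (cmod (f w))\<^sup>2) \<le> 11 / 10 * m z + 11 * e2"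
    unfolding m_def e2_def by (rule sum_moved_le) (use fin \<sigma> in \<open>auto simp: R_def\<close>)
  finally have m2: "(\<Sum>w\<in>\<Omega> - R z. (cmod (f w))\<^sup>2) \<le> 11 / 10 * m z + 11 * e2 + h" by simp
  have split: "(\<Sum>w\<in>\<Omega>. (cmod (f w))\<^sup>2) = m z + (\<Sum>w\<in>\<Omega> - R z. (cmod (f w))\<^sup>2)"
    unfolding m_def using sum.subset_diff[of "R z" \<Omega> "\<lambda>w. (cmod (f w))\<^sup>2"] fin
    by (simp add: R_def)
  have "(\<Sum>w\<in>\<Omega>. (cmod (f w))\<^sup>2) = (\<Sum>c\<in>{One, Minus, Sep}. m c)"
  proof -
    have "reg ` \<Omega> \<subseteq> {One, Minus, Sep}" using reg by (auto intro: sym.exhaust)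
    then have "(\<Sum>w\<in>\<Omega>. (cmod (f w))\<^sup>2) = (\<Sum>c\<in>{One, Minus, Sep}. \<Sum>w | w \<in> \<Omega> \<and> reg w = c. (cmod (f w))\<^sup>2)"
      using sum.group[OF fin, of "{One, Minus, Sep}" reg "\<lambda>w. (cmod (f w))\<^sup>2"] by simp
    then show ?thesis by (simp only: m_def R_def)
  qed
  then have tot: "(\<Sum>w\<in>\<Omega>. (cmod (f w))\<^sup>2) = m One + m Minus + m Sep" by simp
  have pos: "e1 \<ge> 0" "e2 \<ge> 0" "h \<ge> 0" unfolding e1_def e2_def h_def by (auto intro: sum_nonneg)
  \<comment> \<open>Without errors the other two regions would hold at least 10/11 + 100/121 > 17/10
    times \<open>m z\<close>, but \<open>m2\<close> allows only 11/10 times. This bounds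
    \<open>m z\<close>, and then the total, by the errors; 200 is a generous constant.\<close>
  have "m One + m Minus + m Sep \<le> 200 * (e1 + e2 + h)"
    using z m1[of One] m1[of Minus] m1[of Sep] m2 split tot pos
    by (cases z) auto
  then show ?thesis by (simp add: tot e1_def e2_def h_def)
qed


section \<open>Walsh characters on words\<close>

definition sign_of :: "bool \<Rightarrow> complex" where "sign_of b = (if b then -1 else 1)"

lemma sign_of_simps [simp]: "sign_of True = -1" "sign_of False = 1" by (auto simp: sign_of_def)

lemma cmod_sign_of [simp]: "cmod (sign_of b) = 1" by (auto simp: sign_of_def)

lemma cnj_sign_of [simp]: "cnj (sign_of b) = sign_of b" by (auto simp: sign_of_def)

definition sym_dot :: "sym \<Rightarrow> sym \<Rightarrow> bool" where
  "sym_dot c d \<longleftrightarrow> (xbit c \<and> xbit d) \<noteq> (ybit c \<and> ybit d)"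

fun walsh :: "sym list \<Rightarrow> sym list \<Rightarrow> complex" where
  "walsh (c # b) (d # x) = sign_of (sym_dot c d) * walsh b x"
| "walsh _ _ = 1"

lemma sym_dot_rot: "sym_dot c (rot d) = sym_dot (rot c) d"
  by (cases c; cases d) (auto simp: sym_dot_def xbit_def ybit_def)

lemma sym_dot_yflip: "sym_dot c (yflip d) = (ybit c \<noteq> sym_dot c d)"
  by (cases c; cases d) (auto simp: sym_dot_def xbit_def ybit_def)

lemma sym_dot_xflip: "sym_dot (xflip c) d = (xbit d \<noteq> sym_dot c d)"
  by (cases c; cases d) (auto simp: sym_dot_def xbit_def ybit_def)

lemma walsh_rot: "length b = length x \<Longrightarrow> walsh b (map rot x) = walsh (map rot b) x"
  by (induction b x rule: list_induct2) (auto simp: sym_dot_rot)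

text \<open>A flip is a translation, so it multiplies each character by the value of that character
  at the translation, a sign. The flip thus detects frequencies just as the sign generator detects
  differences of indices.\<close>

lemma walsh_bump:
  "length b = length x \<Longrightarrow> walsh b (bump x) = sign_of (b \<noteq> [] \<and> ybit (last b)) * walsh b x"
proof (induction b x rule: list_induct2)
  case (Cons c b d x)
  show ?case
  proof (cases x)
    case Nil
    with Cons show ?thesis by (simp add: sym_dot_yflip sign_of_def)
  next
    case (Cons e x')
    with Cons.hyps have "b \<noteq> []" by auto
    with Cons Cons.IH show ?thesis by simp
  qed
qed simp

text \<open>For \<open>p = False\<close> this makes the two maps transposes of each other. In the
  induction a y-bit carried over from the block before contributes the x-bit of the head to the
  exponent, hence the extra sign.\<close>

lemma walsh_shear:
  "length b = length x \<Longrightarrow>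
    walsh (coshear p b) x = sign_of (p \<and> x \<noteq> [] \<and> xbit (hd x)) * walsh b (shear x)"
  by (induction b x arbitrary: p rule: list_induct2) (auto simp: sym_dot_xflip sym_dot_yflip sign_of_def)

lemma walsh_Zero: "length x = n \<Longrightarrow> walsh (replicate n Zero) x = 1"
  by (induction x arbitrary: n) (auto simp: sym_dot_def xbit_def ybit_def)

lemma cnj_walsh [simp]: "cnj (walsh b x) = walsh b x"
  by (induction b x rule: walsh.induct) auto

lemma walsh_orthogonal:
  "length x = k \<Longrightarrow> length y = k \<Longrightarrow>
    (\<Sum>b\<in>words k. walsh b x * walsh b y) = (if x = y then 4 ^ k else 0)"
proof (induction k arbitrary: x y)
  case 0
  then show ?case by (simp add: words_0)
next
  case (Suc k)
  then obtain c l d m where xy: "x = c # l" "y = d # m" "length l = k" "length m = k"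
    by (auto simp: length_Suc_conv)
  have "(\<Sum>b\<in>words (Suc k). walsh b x * walsh b y) =
      (\<Sum>a\<in>UNIV. sign_of (sym_dot a c) * sign_of (sym_dot a d)) * (\<Sum>b\<in>words k. walsh b l * walsh b m)"
    unfolding xy sum_words_Suc sum_product by (simp add: mult_ac)
  also have "(\<Sum>a\<in>UNIV. sign_of (sym_dot a c) * sign_of (sym_dot a d)) = (if c = d then 4 else 0)"
    unfolding sum_sym by (cases c; cases d) (simp_all add: sym_dot_def xbit_def ybit_def)
  finally show ?case using Suc.IH[OF xy(3,4)] xy by simp
qed

definition walsh_transform :: "nat \<Rightarrow> (sym list \<Rightarrow> complex) \<Rightarrow> sym list \<Rightarrow> complex" where
  "walsh_transform k q b = (\<Sum>x\<in>words k. walsh b x * q x)"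

lemma walsh_transform_diff: "walsh_transform k (\<lambda>x. q x - q' x) b = walsh_transform k q b - walsh_transform k q' b"
  by (simp add: walsh_transform_def right_diff_distrib sum_subtractf)

lemma walsh_transform_parseval:
  "(\<Sum>b\<in>words k. (cmod (walsh_transform k q b))\<^sup>2) = 4 ^ k * (\<Sum>x\<in>words k. (cmod (q x))\<^sup>2)"
proof -
  have "complex_of_real (\<Sum>b\<in>words k. (cmod (walsh_transform k q b))\<^sup>2) =
      (\<Sum>b\<in>words k. \<Sum>x\<in>words k. \<Sum>y\<in>words k. walsh b x * q x * (walsh b y * cnj (q y)))"
    by (simp add: complex_norm_square walsh_transform_def sum_product del: of_real_power)
  also have "\<dots> = (\<Sum>x\<in>words k. \<Sum>y\<in>words k. \<Sum>b\<in>words k. walsh b x * q x * (walsh b y * cnj (q y)))"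
    by (subst sum.swap, rule sum.cong[OF refl], rule sum.swap)
  also have "\<dots> = (\<Sum>x\<in>words k. \<Sum>y\<in>words k. q x * cnj (q y) * (\<Sum>b\<in>words k. walsh b x * walsh b y))"
    by (simp add: sum_distrib_left mult_ac)
  also have "\<dots> = (\<Sum>x\<in>words k. \<Sum>y\<in>words k. if x = y then 4 ^ k * (q x * cnj (q x)) else 0)"
  proof (intro sum.cong refl)
    fix x y assume "x \<in> words k" "y \<in> words k"
    then have "(\<Sum>b\<in>words k. walsh b x * walsh b y) = (if x = y then 4 ^ k else 0)"
      by (intro walsh_orthogonal) (auto simp: words_def)
    then show "q x * cnj (q y) * (\<Sum>b\<in>words k. walsh b x * walsh b y) =
        (if x = y then 4 ^ k * (q x * cnj (q x)) else 0)" by simp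
  qed
  also have "\<dots> = (\<Sum>x\<in>words k. 4 ^ k * (q x * cnj (q x)))"
    by simp
  also have "\<dots> = complex_of_real (4 ^ k * (\<Sum>x\<in>words k. (cmod (q x))\<^sup>2))"
    by (simp add: complex_norm_square sum_distrib_left del: of_real_power) simp
  finally show ?thesis by (simp only: of_real_eq_iff)
qed



section \<open>Generators and conjugation\<close>

datatype gen = GId | GRot | GShear | GZ | GX

fun gen_perm :: "gen \<Rightarrow> sym list \<Rightarrow> sym list" where
  "gen_perm GRot = map rot"
| "gen_perm GShear = shear"
| "gen_perm GX = bump"
| "gen_perm _ = (\<lambda>x. x)"

fun gen_sign :: "gen \<Rightarrow> sym list \<Rightarrow> bool" where
  "gen_sign GZ x \<longleftrightarrow> x \<noteq> [] \<and> xbit (hd x)"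
| "gen_sign _ x \<longleftrightarrow> False"

lemma length_gen_perm [simp]: "length (gen_perm g x) = length x"
  by (cases g) auto

lemma map_rot_inj: "map rot l = map rot m \<Longrightarrow> l = m"
  by (erule map_injective) (simp add: inj_def)

lemma gen_perm_inj: "gen_perm g x = gen_perm g y \<Longrightarrow> x = y"
  by (cases g) (auto dest: map_rot_inj shear_inj bump_inj)

lemma bij_gen_perm: "bij_betw (gen_perm g) (words k) (words k)"
  by (rule bij_words) (auto dest: gen_perm_inj)

text \<open>This is the matrix of \<open>U* F U\<close>, where \<open>U\<close> sends the basis
  vector of \<open>x\<close> to \<open>sign_of (gen_sign g x)\<close> times that of
  \<open>gen_perm g x\<close>.\<close>

definition pull :: "gen \<Rightarrow> (sym list \<Rightarrow> sym list \<Rightarrow> complex) \<Rightarrow> sym list \<Rightarrow> sym list \<Rightarrow> complex" where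
  "pull g F x y = sign_of (gen_sign g x) * sign_of (gen_sign g y) * F (gen_perm g x) (gen_perm g y)"

definition frob_sq :: "nat \<Rightarrow> (sym list \<Rightarrow> sym list \<Rightarrow> complex) \<Rightarrow> real" where
  "frob_sq k F = (\<Sum>x\<in>words k. \<Sum>y\<in>words k. (cmod (F x y))\<^sup>2)"

definition mtrace :: "nat \<Rightarrow> (sym list \<Rightarrow> sym list \<Rightarrow> complex) \<Rightarrow> complex" where
  "mtrace k F = (\<Sum>x\<in>words k. F x x)"

lemma frob_sq_pull: "frob_sq k (pull g F) = frob_sq k F"
proof -
  have "frob_sq k (pull g F) = (\<Sum>x\<in>words k. \<Sum>y\<in>words k. (cmod (F (gen_perm g x) (gen_perm g y)))\<^sup>2)"
    by (simp add: frob_sq_def pull_def norm_mult)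
  also have "\<dots> = (\<Sum>x\<in>words k. \<Sum>y\<in>words k. (cmod (F (gen_perm g x) y))\<^sup>2)"
    by (intro sum.cong refl sum.reindex_bij_betw[OF bij_gen_perm])
  also have "\<dots> = frob_sq k F"
    unfolding frob_sq_def
    by (rule sum.reindex_bij_betw[OF bij_gen_perm, where g = "\<lambda>x. \<Sum>y\<in>words k. (cmod (F x y))\<^sup>2"])
  finally show ?thesis .
qed

lemma mtrace_pull: "mtrace k (pull g F) = mtrace k F"
proof -
  have "sign_of b * sign_of b = 1" for b by (simp add: sign_of_def)
  then have "mtrace k (pull g F) = (\<Sum>x\<in>words k. F (gen_perm g x) (gen_perm g x))"
    by (simp add: mtrace_def pull_def)
  also have "\<dots> = mtrace k F"
    unfolding mtrace_def by (rule sum.reindex_bij_betw[OF bij_gen_perm, where g = "\<lambda>x. F x x"])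
  finally show ?thesis .
qed

definition offdiag :: "nat \<Rightarrow> (sym list \<times> sym list) set" where
  "offdiag k = {(x, y). x \<in> words k \<and> y \<in> words k \<and> x \<noteq> y}"

lemma finite_offdiag [simp]: "finite (offdiag k)"
proof (rule finite_subset)
  show "offdiag k \<subseteq> words k \<times> words k" by (auto simp: offdiag_def)
qed simp

lemma frob_sq_split:
  "frob_sq k F = (\<Sum>(x, y)\<in>offdiag k. (cmod (F x y))\<^sup>2) + (\<Sum>x\<in>words k. (cmod (F x x))\<^sup>2)"
proof -
  have "frob_sq k F = (\<Sum>(x, y)\<in>words k \<times> words k. (cmod (F x y))\<^sup>2)"
    by (simp add: frob_sq_def sum.cartesian_product)
  also have "words k \<times> words k = offdiag k \<union> (\<lambda>x. (x, x)) ` words k"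
    by (auto simp: offdiag_def)
  also have "(\<Sum>(x, y)\<in>\<dots>. (cmod (F x y))\<^sup>2) = (\<Sum>(x, y)\<in>offdiag k. (cmod (F x y))\<^sup>2) +
      (\<Sum>(x, y)\<in>(\<lambda>x. (x, x)) ` words k. (cmod (F x y))\<^sup>2)"
    by (rule sum.union_disjoint) (simp, simp, auto simp: offdiag_def)
  also have "(\<Sum>(x, y)\<in>(\<lambda>x. (x, x)) ` words k. (cmod (F x y))\<^sup>2) = (\<Sum>x\<in>words k. (cmod (F x x))\<^sup>2)"
    by (simp add: sum.reindex inj_on_def)
  finally show ?thesis .
qed

text \<open>An off-diagonal entry \<open>(x, y)\<close> is classified by the first block in which \<open>x + y\<close> is nonzero. A
  shear moves its position forward by one, unless it already is the first block; there the
  sign generator detects it.\<close>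

lemma offdiag_gap:
  "(\<Sum>(x, y)\<in>offdiag k. (cmod (F x y))\<^sup>2) \<le>
    200 * (\<Sum>g\<leftarrow>[GRot, GShear, GZ]. \<Sum>(x, y)\<in>offdiag k. (cmod (pull g F x y - F x y))\<^sup>2)"
proof -
  define f where "f = (\<lambda>(x, y). F x y)"
  define H where "H = {(x, y) \<in> offdiag k. xbit (hd x) \<noteq> xbit (hd y)}"
  have "(\<Sum>w\<in>offdiag k. (cmod (f w))\<^sup>2) \<le>
    200 * ((\<Sum>w\<in>offdiag k. (cmod (f (map_prod (map rot) (map rot) w) - f w))\<^sup>2)
      + (\<Sum>w\<in>offdiag k. (cmod (f (map_prod shear shear w) - f w))\<^sup>2)
      + (\<Sum>w\<in>H. (cmod (f w))\<^sup>2))"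
  proof (rule almost_invariant_mass[where reg = "\<lambda>(x, y). first_diff x y" and z = Minus])
    have "first_diff (shear x) (shear y) = Minus"
      if "(x, y) \<in> offdiag k" "(x, y) \<notin> H" "first_diff x y \<noteq> Minus" for x y
    proof -
      have "length x = length y" "x \<noteq> y" using that by (auto simp: offdiag_def words_def)
      \<comment> \<open>\<open>One\<close> and \<open>Sep\<close>, the nonzero symbols other than
        \<open>Minus\<close>, both have an x-bit.\<close>
      then have "xbit (first_diff x y)" using that(3) first_diff_eq_Zero[of x y]
        by (cases "first_diff x y") (auto simp: xbit_def)
      with that show ?thesis using first_diff_shear[of x y] by (auto simp: offdiag_def words_def H_def)
    qed
    then show "map_prod shear shear w \<in> offdiag k \<and> (case map_prod shear shear w of (x, y) \<Rightarrow> first_diff x y) = Minus"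
      if "w \<in> offdiag k" "w \<notin> H" "(case w of (x, y) \<Rightarrow> first_diff x y) \<noteq> Minus" for w
      using that by (auto simp: offdiag_def words_def dest: shear_inj)
  qed (simp, auto simp: H_def offdiag_def words_def first_diff_eq_Zero first_diff_rot inj_on_def
      dest: map_rot_inj shear_inj)
  moreover have "(\<Sum>w\<in>H. (cmod (f w))\<^sup>2) \<le> (\<Sum>(x, y)\<in>offdiag k. (cmod (pull GZ F x y - F x y))\<^sup>2)"
  proof -
    have "(\<Sum>w\<in>H. (cmod (f w))\<^sup>2) \<le> (\<Sum>(x, y)\<in>H. (cmod (pull GZ F x y - F x y))\<^sup>2)"
    proof (rule sum_mono, clarify)
      fix x y assume xy: "(x, y) \<in> H"
      then have "x \<noteq> []" "y \<noteq> []" by (cases x; cases y; auto simp: H_def offdiag_def words_def)+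
      \<comment> \<open>On \<open>H\<close> exactly one of the two signs is -1, so \<open>GZ\<close>
        negates the entry.\<close>
      then have "pull GZ F x y - F x y = - 2 * F x y"
        using xy by (auto simp: H_def pull_def sign_of_def)
      then have "cmod (pull GZ F x y - F x y) = 2 * cmod (F x y)"
        by (simp only: norm_mult norm_neg_numeral)
      then show "(cmod (f (x, y)))\<^sup>2 \<le> (cmod (pull GZ F x y - F x y))\<^sup>2"
        by (simp add: f_def power_mult_distrib)
    qed
    also have "\<dots> \<le> (\<Sum>(x, y)\<in>offdiag k. (cmod (pull GZ F x y - F x y))\<^sup>2)"
      by (rule sum_mono2) (auto simp: H_def)
    finally show ?thesis .
  qed
  ultimately show ?thesis
    by (simp add: f_def pull_def split_def)
qed

text \<open>The diagonal is handled dually: the frequencies of its Walsh transform are classified by their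
  last nonzero block, whose position the transposed shear moves back by one.\<close>

lemma diag_gap:
  assumes "mtrace k F = 0"
  shows "(\<Sum>x\<in>words k. (cmod (F x x))\<^sup>2) \<le>
    200 * (\<Sum>g\<leftarrow>[GRot, GShear, GX]. \<Sum>x\<in>words k. (cmod (pull g F x x - F x x))\<^sup>2)"
proof -
  define q where "q x = F x x" for x
  define \<Omega> where "\<Omega> = words k - {replicate k Zero}"
  define H where "H = {b \<in> \<Omega>. ybit (last b)}"
  \<comment> \<open>The trace is the coefficient at frequency zero. Since it vanishes, restricting
    Parseval's identity to \<Omega> loses nothing, as \<open>eq\<close> records.\<close>
  have z0: "walsh_transform k q (replicate k Zero) = 0"
    using assms by (simp add: walsh_transform_def mtrace_def q_def walsh_Zero words_def)
  have par: "(\<Sum>b\<in>\<Omega>. (cmod (walsh_transform k u b))\<^sup>2) \<le> 4 ^ k * (\<Sum>x\<in>words k. (cmod (u x))\<^sup>2)" for u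
    unfolding walsh_transform_parseval[symmetric] \<Omega>_def by (rule sum_mono2) auto
  have eq: "(\<Sum>b\<in>\<Omega>. (cmod (walsh_transform k q b))\<^sup>2) = 4 ^ k * (\<Sum>x\<in>words k. (cmod (q x))\<^sup>2)"
    unfolding walsh_transform_parseval[symmetric] \<Omega>_def
    by (rule sum.mono_neutral_left) (auto simp: z0)
  have tr: "walsh_transform k q (h b) = walsh_transform k (\<lambda>x. q (gen_perm g x)) b'"
    if "\<And>x. x \<in> words k \<Longrightarrow> walsh (h b) (gen_perm g x) = walsh b' x" for g h b b'
  proof -
    have "walsh_transform k q (h b) = (\<Sum>x\<in>words k. walsh (h b) (gen_perm g x) * q (gen_perm g x))"
      unfolding walsh_transform_def by (rule sum.reindex_bij_betw[OF bij_gen_perm, symmetric])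
    then show ?thesis using that by (simp add: walsh_transform_def)
  qed
  have tr_rot: "walsh_transform k (\<lambda>x. q (map rot x)) (map rot b) = walsh_transform k q b" if "b \<in> words k" for b
    using tr[of "\<lambda>b. b" b GRot "map rot b"] that by (simp add: walsh_rot words_def)
  have tr_shear: "walsh_transform k (\<lambda>x. q (shear x)) (coshear False b) = walsh_transform k q b" if "b \<in> words k" for b
    using tr[of "\<lambda>b. b" b GShear "coshear False b"] that walsh_shear[of b _ False]
    by (simp add: words_def)
  have sg_sq: "sign_of p * (sign_of p * c) = c" for p c by (simp add: sign_of_def)
  have tr_bump: "walsh_transform k (\<lambda>x. q (bump x)) b = sign_of (b \<noteq> [] \<and> ybit (last b)) * walsh_transform k q b"
    if "b \<in> words k" for b
  proof -
    have "walsh_transform k q b = (\<Sum>x\<in>words k. walsh b (bump x) * q (bump x))"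
      unfolding walsh_transform_def using sum.reindex_bij_betw[OF bij_gen_perm[of GX], symmetric] by simp
    also have "\<dots> = sign_of (b \<noteq> [] \<and> ybit (last b)) * walsh_transform k (\<lambda>x. q (bump x)) b"
      unfolding walsh_transform_def sum_distrib_left
      using that by (intro sum.cong refl) (simp add: walsh_bump words_def)
    finally show ?thesis by (simp add: sg_sq)
  qed
  have "(\<Sum>b\<in>\<Omega>. (cmod (walsh_transform k q b))\<^sup>2) \<le>
    200 * ((\<Sum>b\<in>\<Omega>. (cmod (walsh_transform k q (map rot b) - walsh_transform k q b))\<^sup>2)
      + (\<Sum>b\<in>\<Omega>. (cmod (walsh_transform k q (coshear False b) - walsh_transform k q b))\<^sup>2)
      + (\<Sum>b\<in>H. (cmod (walsh_transform k q b))\<^sup>2))"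
  proof (rule almost_invariant_mass[where reg = last_nonzero and z = One])
    have nz: "last_nonzero b \<noteq> Zero \<longleftrightarrow> b \<noteq> replicate k Zero" if "b \<in> words k" for b
      using that last_nonzero_eq_Zero[of b] by (auto simp: words_def)
    show "last_nonzero b \<noteq> Zero" if "b \<in> \<Omega>" for b
      using that nz[of b] by (simp add: \<Omega>_def)
    show "map rot b \<in> \<Omega> \<and> last_nonzero (map rot b) = rot (last_nonzero b)" if "b \<in> \<Omega>" for b
    proof -
      have "last_nonzero (map rot b) = rot (last_nonzero b)" by (rule last_nonzero_rot)
      moreover from that have "rot (last_nonzero b) \<noteq> Zero"
        using nz[of b] by (cases "last_nonzero b") (auto simp: \<Omega>_def)
      ultimately show ?thesis using nz[of "map rot b"] that by (auto simp: \<Omega>_def words_def)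
    qed
    show "coshear False b \<in> \<Omega> \<and> last_nonzero (coshear False b) = One"
      if "b \<in> \<Omega>" "b \<notin> H" "last_nonzero b \<noteq> One" for b
    proof -
      have "ybit (last_nonzero b)" using that nz[of b] by (cases "last_nonzero b") (auto simp: \<Omega>_def ybit_def)
      with that have "last_nonzero (coshear False b) = One"
        by (intro last_nonzero_coshear) (auto simp: H_def)
      then show ?thesis using nz[of "coshear False b"] that by (auto simp: \<Omega>_def words_def)
    qed
  qed (auto simp: H_def \<Omega>_def inj_on_def dest: map_rot_inj coshear_inj)
  \<comment> \<open>Both terms become coefficients at the same frequency: the value at
    \<open>b\<close> is the coefficient of the moved function at \<open>map rot b\<close>. Parseval
    then turns a displacement of frequencies into one of the diagonal.\<close>
  also have "(\<Sum>b\<in>\<Omega>. (cmod (walsh_transform k q (map rot b) - walsh_transform k q b))\<^sup>2)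
      = (\<Sum>b\<in>\<Omega>. (cmod (walsh_transform k (\<lambda>x. q x - q (map rot x)) (map rot b)))\<^sup>2)"
    by (intro sum.cong refl) (simp add: walsh_transform_diff tr_rot \<Omega>_def)
  also have "\<dots> \<le> 4 ^ k * (\<Sum>x\<in>words k. (cmod (q x - q (map rot x)))\<^sup>2)"
  proof -
    have "(\<Sum>b\<in>\<Omega>. (cmod (walsh_transform k u (map rot b)))\<^sup>2) \<le> (\<Sum>b\<in>words k. (cmod (walsh_transform k u (map rot b)))\<^sup>2)" for u
      by (rule sum_mono2) (auto simp: \<Omega>_def)
    also have "(\<Sum>b\<in>words k. (cmod (walsh_transform k u (map rot b)))\<^sup>2) = (\<Sum>b\<in>words k. (cmod (walsh_transform k u b))\<^sup>2)" for u
      by (rule sum.reindex_bij_betw) (auto intro: bij_words dest: map_rot_inj)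
    finally show ?thesis unfolding walsh_transform_parseval .
  qed
  also have "(\<Sum>b\<in>\<Omega>. (cmod (walsh_transform k q (coshear False b) - walsh_transform k q b))\<^sup>2)
      = (\<Sum>b\<in>\<Omega>. (cmod (walsh_transform k (\<lambda>x. q x - q (shear x)) (coshear False b)))\<^sup>2)"
    by (intro sum.cong refl) (simp add: walsh_transform_diff tr_shear \<Omega>_def)
  also have "\<dots> \<le> 4 ^ k * (\<Sum>x\<in>words k. (cmod (q x - q (shear x)))\<^sup>2)"
  proof -
    have "(\<Sum>b\<in>\<Omega>. (cmod (walsh_transform k u (coshear False b)))\<^sup>2) \<le> (\<Sum>b\<in>words k. (cmod (walsh_transform k u (coshear False b)))\<^sup>2)" for u
      by (rule sum_mono2) (auto simp: \<Omega>_def)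
    also have "(\<Sum>b\<in>words k. (cmod (walsh_transform k u (coshear False b)))\<^sup>2) = (\<Sum>b\<in>words k. (cmod (walsh_transform k u b))\<^sup>2)" for u
      by (rule sum.reindex_bij_betw) (auto intro: bij_words dest: coshear_inj)
    finally show ?thesis unfolding walsh_transform_parseval .
  qed
  also have "(\<Sum>b\<in>H. (cmod (walsh_transform k q b))\<^sup>2) \<le> 4 ^ k * (\<Sum>x\<in>words k. (cmod (q x - q (bump x)))\<^sup>2)"
  proof -
    have "(\<Sum>b\<in>H. (cmod (walsh_transform k q b))\<^sup>2) \<le> (\<Sum>b\<in>H. (cmod (walsh_transform k (\<lambda>x. q x - q (bump x)) b))\<^sup>2)"
    proof (rule sum_mono)
      fix b assume b: "b \<in> H"
      then have "b \<noteq> []" by (auto simp: H_def \<Omega>_def words_def)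
      with b have "walsh_transform k (\<lambda>x. q x - q (bump x)) b = 2 * walsh_transform k q b"
        by (simp add: walsh_transform_diff tr_bump H_def \<Omega>_def)
      then show "(cmod (walsh_transform k q b))\<^sup>2 \<le> (cmod (walsh_transform k (\<lambda>x. q x - q (bump x)) b))\<^sup>2"
        by (simp add: norm_mult power_mult_distrib)
    qed
    also have "\<dots> \<le> (\<Sum>b\<in>words k. (cmod (walsh_transform k (\<lambda>x. q x - q (bump x)) b))\<^sup>2)"
      by (rule sum_mono2) (auto simp: H_def \<Omega>_def)
    finally show ?thesis unfolding walsh_transform_parseval .
  qed
  finally have "4 ^ k * (\<Sum>x\<in>words k. (cmod (q x))\<^sup>2) \<le> 4 ^ k * (200 *
      ((\<Sum>x\<in>words k. (cmod (q x - q (map rot x)))\<^sup>2) + (\<Sum>x\<in>words k. (cmod (q x - q (shear x)))\<^sup>2)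
        + (\<Sum>x\<in>words k. (cmod (q x - q (bump x)))\<^sup>2)))"
    unfolding eq by (simp add: algebra_simps)
  then show ?thesis
    by (simp add: q_def pull_def norm_minus_commute)
qed

text \<open>The estimates off and on the diagonal add up. Each lacks one generator,
  \<open>GX\<close> and \<open>GZ\<close> respectively, whose missing error terms are
  nonnegative.\<close>

lemma gap:
  assumes "mtrace k F = 0"
  shows "frob_sq k F \<le> 200 * (\<Sum>g\<leftarrow>[GRot, GShear, GZ, GX]. frob_sq k (\<lambda>x y. pull g F x y - F x y))"
proof -
  have pos: "0 \<le> (\<Sum>(x, y)\<in>offdiag k. (cmod (G x y))\<^sup>2)" "0 \<le> (\<Sum>x\<in>words k. (cmod (G x x))\<^sup>2)" for G
    by (auto intro!: sum_nonneg)
  show ?thesis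
    using offdiag_gap[of F k] diag_gap[OF assms] pos[of "\<lambda>x y. pull GX F x y - F x y"]
      pos[of "\<lambda>x y. pull GZ F x y - F x y"]
    unfolding frob_sq_split by simp
qed

section \<open>Averaging over the generators\<close>

definition gens :: "gen list" where "gens = [GId, GRot, GShear, GZ, GX]"

definition gen_avg :: "(sym list \<Rightarrow> sym list \<Rightarrow> complex) \<Rightarrow> sym list \<Rightarrow> sym list \<Rightarrow> complex" where
  "gen_avg F x y = (\<Sum>g\<leftarrow>gens. pull g F x y) / 5"

text \<open>The mean of the squares exceeds the square of the mean by 1/25 of the sum of the squared
  distances over all pairs; only the pairs containing \<open>a\<close> are kept. Here
  \<open>a\<close> will belong to the identity generator, so that the distances become the
  displacements bounded in \<open>gap\<close>.\<close>

lemma cmod_mean_le: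
  "(cmod ((a + b + c + d + e) / 5))\<^sup>2 \<le>
    ((cmod a)\<^sup>2 + (cmod b)\<^sup>2 + (cmod c)\<^sup>2 + (cmod d)\<^sup>2 + (cmod e)\<^sup>2) / 5 -
    ((cmod (b - a))\<^sup>2 + (cmod (c - a))\<^sup>2 + (cmod (d - a))\<^sup>2 + (cmod (e - a))\<^sup>2) / 25"
proof -
  have real: "(p + q + r + s + t)\<^sup>2 / 25 \<le> (p\<^sup>2 + q\<^sup>2 + r\<^sup>2 + s\<^sup>2 + t\<^sup>2) / 5 -
      ((q - p)\<^sup>2 + (r - p)\<^sup>2 + (s - p)\<^sup>2 + (t - p)\<^sup>2) / 25" for p q r s t :: real
  proof -
    have "0 \<le> (q - r)\<^sup>2 + (q - s)\<^sup>2 + (q - t)\<^sup>2 + (r - s)\<^sup>2 + (r - t)\<^sup>2 + (s - t)\<^sup>2" by simp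
    then show ?thesis by (simp add: power2_eq_square field_simps)
  qed
  show ?thesis
    using add_mono[OF real[of "Re a" "Re b" "Re c" "Re d" "Re e"] real[of "Im a" "Im b" "Im c" "Im d" "Im e"]]
    by (simp add: cmod_power2 power_divide) argo
qed

lemma frob_sq_gen_avg_le:
  assumes "mtrace k F = 0"
  shows "frob_sq k (gen_avg F) \<le> (1 - 1 / 5000) * frob_sq k F"
proof -
  have "frob_sq k (gen_avg F) \<le> (\<Sum>x\<in>words k. \<Sum>y\<in>words k.
     ((cmod (pull GId F x y))\<^sup>2 + (cmod (pull GRot F x y))\<^sup>2 + (cmod (pull GShear F x y))\<^sup>2 +
       (cmod (pull GZ F x y))\<^sup>2 + (cmod (pull GX F x y))\<^sup>2) / 5 -
     ((cmod (pull GRot F x y - pull GId F x y))\<^sup>2 + (cmod (pull GShear F x y - pull GId F x y))\<^sup>2 +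
       (cmod (pull GZ F x y - pull GId F x y))\<^sup>2 + (cmod (pull GX F x y - pull GId F x y))\<^sup>2) / 25)"
    unfolding frob_sq_def gen_avg_def gens_def
    by (intro sum_mono) (use cmod_mean_le in \<open>simp add: add.assoc\<close>)
  also have "\<dots> = (\<Sum>g\<leftarrow>gens. frob_sq k (pull g F)) / 5 -
      (\<Sum>g\<leftarrow>[GRot, GShear, GZ, GX]. frob_sq k (\<lambda>x y. pull g F x y - pull GId F x y)) / 25"
    by (simp add: frob_sq_def gens_def sum.distrib sum_subtractf sum_divide_distrib add_divide_distrib)
  also have "\<dots> = frob_sq k F - (\<Sum>g\<leftarrow>[GRot, GShear, GZ, GX]. frob_sq k (\<lambda>x y. pull g F x y - F x y)) / 25"
    by (simp add: frob_sq_pull gens_def) (simp add: pull_def)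
  \<comment> \<open>5000 is 25 times the constant 200 of the gap.\<close>
  also have "\<dots> \<le> (1 - 1 / 5000) * frob_sq k F"
    using gap[OF assms] by simp
  finally show ?thesis .
qed

section \<open>Expansion of averaged conjugations\<close>

fun word_perm :: "gen list \<Rightarrow> sym list \<Rightarrow> sym list" where
  "word_perm [] x = x"
| "word_perm (g # w) x = word_perm w (gen_perm g x)"

fun word_sign :: "gen list \<Rightarrow> sym list \<Rightarrow> bool" where
  "word_sign [] x = False"
| "word_sign (g # w) x = (gen_sign g x \<noteq> word_sign w (gen_perm g x))"

definition word_pull :: "gen list \<Rightarrow> (sym list \<Rightarrow> sym list \<Rightarrow> complex) \<Rightarrow> sym list \<Rightarrow> sym list \<Rightarrow> complex" where
  "word_pull w F x y = sign_of (word_sign w x) * sign_of (word_sign w y) * F (word_perm w x) (word_perm w y)"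

lemma length_word_perm [simp]: "length (word_perm w x) = length x"
  by (induction w arbitrary: x) auto

lemma word_perm_inj: "word_perm w x = word_perm w y \<Longrightarrow> x = y"
  by (induction w arbitrary: x y) (auto dest: gen_perm_inj)

lemma bij_word_perm: "bij_betw (word_perm w) (words k) (words k)"
  by (rule bij_words) (auto dest: word_perm_inj)

lemma sign_of_neq: "sign_of (a = (\<not> b)) = sign_of a * sign_of b"
  by (cases a; cases b) auto

lemma word_pull_Nil: "word_pull [] F = F"
  by (simp add: word_pull_def fun_eq_iff)

lemma word_pull_Cons: "word_pull (g # w) F = pull g (word_pull w F)"
  by (simp add: word_pull_def pull_def fun_eq_iff sign_of_neq mult_ac)

text \<open>Conjugations compose, so iterating the average is averaging over words; the price for a
  power of the contraction factor is \<open>5 ^ t\<close> maps.\<close>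

lemma gen_avg_power:
  "(gen_avg ^^ t) F x y = (\<Sum>w\<leftarrow>List.n_lists t gens. word_pull w F x y) / 5 ^ t"
proof (induction t arbitrary: x y)
  case 0
  then show ?case by (simp add: word_pull_Nil)
next
  case (Suc t)
  have conc: "(\<Sum>w\<leftarrow>concat (map (\<lambda>ys. map (\<lambda>y. y # ys) gens) ws). word_pull w F x y) =
      (\<Sum>g\<leftarrow>gens. \<Sum>w\<leftarrow>ws. pull g (word_pull w F) x y)" for ws
    by (induction ws) (simp_all add: gens_def word_pull_Cons)
  have lin: "pull g ((gen_avg ^^ t) F) x y = (\<Sum>w\<leftarrow>List.n_lists t gens. pull g (word_pull w F) x y) / 5 ^ t" for g
    by (simp add: pull_def Suc.IH sum_list_const_mult)
  have "(gen_avg ^^ Suc t) F x y = (\<Sum>g\<leftarrow>gens. (\<Sum>w\<leftarrow>List.n_lists t gens. pull g (word_pull w F) x y) / 5 ^ t) / 5"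
    by (simp only: funpow.simps comp_apply gen_avg_def lin)
  also have "\<dots> = (\<Sum>g\<leftarrow>gens. \<Sum>w\<leftarrow>List.n_lists t gens. pull g (word_pull w F) x y) / 5 ^ Suc t"
    by (simp add: gens_def add_divide_distrib mult.commute)
  finally show ?case by (simp add: conc)
qed

lemma mtrace_gen_avg: "mtrace k (gen_avg F) = mtrace k F"
proof -
  have "mtrace k (gen_avg F) = (\<Sum>g\<leftarrow>gens. mtrace k (pull g F)) / 5"
    by (simp add: mtrace_def gen_avg_def gens_def sum.distrib sum_divide_distrib add_divide_distrib)
  then show ?thesis by (simp add: mtrace_pull gens_def)
qed

lemma frob_sq_gen_avg_power_le:
  assumes "mtrace k F = 0"
  shows "frob_sq k ((gen_avg ^^ t) F) \<le> (1 - 1 / 5000) ^ t * frob_sq k F"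
proof (induction t)
  case (Suc t)
  have "mtrace k ((gen_avg ^^ t) F) = 0"
    by (induction t) (simp_all add: assms mtrace_gen_avg)
  from frob_sq_gen_avg_le[OF this] Suc show ?case by simp
qed simp

section \<open>Frobenius products and projection kernels\<close>

definition frob_inner :: "nat \<Rightarrow> (sym list \<Rightarrow> sym list \<Rightarrow> complex) \<Rightarrow> (sym list \<Rightarrow> sym list \<Rightarrow> complex) \<Rightarrow> complex" where
  "frob_inner k F G = (\<Sum>x\<in>words k. \<Sum>y\<in>words k. F x y * cnj (G x y))"

lemma frob_inner_Cauchy_Schwarz: "(cmod (frob_inner k F G))\<^sup>2 \<le> frob_sq k F * frob_sq k G"
proof -
  let ?S = "words k \<times> words k"
  have "cmod (frob_inner k F G) \<le> (\<Sum>p\<in>?S. cmod (F (fst p) (snd p)) * cmod (G (fst p) (snd p)))"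
    unfolding frob_inner_def sum.cartesian_product split_def
    by (rule order_trans[OF norm_sum]) (simp add: norm_mult)
  also have "\<dots> \<le> L2_set (\<lambda>p. cmod (F (fst p) (snd p))) ?S * L2_set (\<lambda>p. cmod (G (fst p) (snd p))) ?S"
    using L2_set_mult_ineq[of "\<lambda>p. cmod (F (fst p) (snd p))" "\<lambda>p. cmod (G (fst p) (snd p))" ?S] by simp
  finally have "(cmod (frob_inner k F G))\<^sup>2 \<le>
      (L2_set (\<lambda>p. cmod (F (fst p) (snd p))) ?S * L2_set (\<lambda>p. cmod (G (fst p) (snd p))) ?S)\<^sup>2"
    by (intro power_mono) auto
  also have "\<dots> = frob_sq k F * frob_sq k G"
    by (simp add: frob_sq_def sum.cartesian_product split_def power_mult_distrib L2_set_def sum_nonneg)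
  finally show ?thesis .
qed

lemma frob_sq_frob_inner: "complex_of_real (frob_sq k F) = frob_inner k F F"
  by (simp add: frob_sq_def frob_inner_def complex_norm_square del: of_real_power)

lemma frob_inner_sum_list: "frob_inner k (\<lambda>x y. (\<Sum>w\<leftarrow>ws. F w x y)) G = (\<Sum>w\<leftarrow>ws. frob_inner k (F w) G)"
  by (induction ws) (simp_all add: frob_inner_def sum.distrib distrib_right)

lemma frob_inner_divide: "frob_inner k (\<lambda>x y. F x y / c) G = frob_inner k F G / c"
  by (simp add: frob_inner_def sum_divide_distrib)

lemma frob_inner_gen_avg_power:
  assumes "\<And>w. w \<in> set (List.n_lists t gens) \<Longrightarrow> frob_inner k (word_pull w F) G = c"
  shows "frob_inner k ((gen_avg ^^ t) F) G = c"
proof -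
  have "frob_inner k ((gen_avg ^^ t) F) G = (\<Sum>w\<leftarrow>List.n_lists t gens. frob_inner k (word_pull w F) G) / 5 ^ t"
    by (subst frob_inner_sum_list[symmetric], subst frob_inner_divide[symmetric]) (simp add: frob_inner_def gen_avg_power)
  also have "(\<Sum>w\<leftarrow>List.n_lists t gens. frob_inner k (word_pull w F) G) = (\<Sum>w\<leftarrow>List.n_lists t gens. c)"
    using assms by (intro arg_cong[where f = sum_list] map_cong) auto
  also have "\<dots> = 5 ^ t * c"
    by (simp add: sum_list_triv length_n_lists) (simp add: gens_def)
  finally show ?thesis by simp
qed

definition orthonormal :: "nat \<Rightarrow> nat \<Rightarrow> (nat \<Rightarrow> sym list \<Rightarrow> complex) \<Rightarrow> bool" where
  "orthonormal k r E \<longleftrightarrow> (\<forall>i<r. \<forall>j<r. (\<Sum>x\<in>words k. E i x * cnj (E j x)) = (if i = j then 1 else 0))"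

definition proj_kernel :: "nat \<Rightarrow> (nat \<Rightarrow> sym list \<Rightarrow> complex) \<Rightarrow> sym list \<Rightarrow> sym list \<Rightarrow> complex" where
  "proj_kernel r E x y = (\<Sum>i<r. E i x * cnj (E i y))"

definition id_kernel :: "sym list \<Rightarrow> sym list \<Rightarrow> complex" where
  "id_kernel x y = (if x = y then 1 else 0)"

lemma card_words: "card (words k) = 4 ^ k"
proof (induction k)
  case (Suc k)
  have "card (words (Suc k)) = card ((UNIV :: sym set) \<times> words k)"
    unfolding words_Suc by (rule card_image) (auto simp: inj_on_def)
  also have "\<dots> = 4 * card (words k)" by (simp add: card_cartesian_product UNIV_sym)
  finally show ?case using Suc by simp
qed (simp add: words_0)

lemma mtrace_proj_kernel: "orthonormal k r E \<Longrightarrow> mtrace k (proj_kernel r E) = of_nat r"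
  unfolding mtrace_def proj_kernel_def by (subst sum.swap) (simp add: orthonormal_def)

lemma proj_kernel_apply:
  assumes "orthonormal k r E" "i < r"
  shows "(\<Sum>y\<in>words k. proj_kernel r E x y * E i y) = E i x"
proof -
  have "(\<Sum>y\<in>words k. proj_kernel r E x y * E i y) = (\<Sum>y\<in>words k. \<Sum>j<r. E j x * (E i y * cnj (E j y)))"
    unfolding proj_kernel_def sum_distrib_right by (intro sum.cong refl) (simp add: mult_ac)
  also have "\<dots> = (\<Sum>j<r. E j x * (\<Sum>y\<in>words k. E i y * cnj (E j y)))"
    by (subst sum.swap) (simp add: sum_distrib_left)
  also have "\<dots> = (\<Sum>j<r. if i = j then E j x else 0)"
    using assms by (intro sum.cong refl) (auto simp: orthonormal_def)
  also have "\<dots> = E i x" using assms(2) by simp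
  finally show ?thesis .
qed

lemma frob_inner_proj_kernel_right:
  "frob_inner k F (proj_kernel r E) = (\<Sum>i<r. \<Sum>x\<in>words k. \<Sum>y\<in>words k. F x y * (cnj (E i x) * E i y))"
proof -
  have "frob_inner k F (proj_kernel r E) = (\<Sum>x\<in>words k. \<Sum>y\<in>words k. \<Sum>i<r. F x y * (cnj (E i x) * E i y))"
    by (simp add: frob_inner_def proj_kernel_def sum_distrib_left)
  also have "\<dots> = (\<Sum>x\<in>words k. \<Sum>i<r. \<Sum>y\<in>words k. F x y * (cnj (E i x) * E i y))"
    by (intro sum.cong refl sum.swap)
  also have "\<dots> = (\<Sum>i<r. \<Sum>x\<in>words k. \<Sum>y\<in>words k. F x y * (cnj (E i x) * E i y))"
    by (rule sum.swap)
  finally show ?thesis .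
qed

lemma frob_inner_id_kernel_left: "frob_inner k id_kernel G = cnj (mtrace k G)"
proof -
  have "frob_inner k id_kernel G = (\<Sum>x\<in>words k. \<Sum>y\<in>words k. if x = y then cnj (G x x) else 0)"
    unfolding frob_inner_def id_kernel_def by (intro sum.cong refl) auto
  then show ?thesis by (simp add: mtrace_def)
qed

lemma frob_inner_commute: "frob_inner k F G = cnj (frob_inner k G F)"
  by (simp add: frob_inner_def mult.commute)

lemma frob_inner_diff_left: "frob_inner k (\<lambda>x y. F x y - c * G x y) H = frob_inner k F H - c * frob_inner k G H"
  by (simp add: frob_inner_def left_diff_distrib sum_subtractf sum_distrib_left mult.assoc)

lemma frob_sq_proj_kernel:
  assumes "orthonormal k r E"
  shows "frob_sq k (proj_kernel r E) = real r"
proof -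
  have "frob_inner k (proj_kernel r E) (proj_kernel r E) = (\<Sum>i<r. \<Sum>x\<in>words k. cnj (E i x) * (\<Sum>y\<in>words k. proj_kernel r E x y * E i y))"
    by (simp add: frob_inner_proj_kernel_right sum_distrib_left mult_ac)
  also have "\<dots> = (\<Sum>i<r. \<Sum>x\<in>words k. E i x * cnj (E i x))"
    by (simp add: proj_kernel_apply[OF assms]) (simp add: mult.commute)
  also have "\<dots> = of_nat r" using assms by (simp add: orthonormal_def)
  finally have "complex_of_real (frob_sq k (proj_kernel r E)) = complex_of_real (real r)"
    by (simp add: frob_sq_frob_inner)
  then show ?thesis by (simp only: of_real_eq_iff)
qed

lemma word_pull_diff_id_kernel:
  "word_pull w (\<lambda>x y. F x y - c * id_kernel x y) = (\<lambda>x y. word_pull w F x y - c * id_kernel x y)"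
proof -
  have "sign_of b * sign_of b = 1" for b by (simp add: sign_of_def)
  then show ?thesis
    by (auto simp: fun_eq_iff word_pull_def id_kernel_def right_diff_distrib dest: word_perm_inj)
qed

text \<open>The function \<open>v\<close> is the image of \<open>E i\<close> under the unitary of the word \<open>w\<close>, and its second property
  says that it lies in the span of \<open>E'\<close>. The proof compares the averaged conjugates of the
  projection onto that span, minus its trace part, with the projection onto the span of \<open>E\<close>.\<close>

lemma expansion_core:
  assumes E: "orthonormal k r E" and E': "orthonormal k r' E'"
    and V: "\<And>w i. w \<in> set (List.n_lists t gens) \<Longrightarrow> i < r \<Longrightarrow>
      \<exists>v. (\<forall>x\<in>words k. v (word_perm w x) = sign_of (word_sign w x) * E i x) \<and>
        (\<forall>x\<in>words k. v x = (\<Sum>j<r'. (\<Sum>y\<in>words k. v y * cnj (E' j y)) * E' j x))"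
  shows "(real r - real r' / 4 ^ k * real r)\<^sup>2 \<le>
    (1 - 1 / 5000) ^ t * (real r' - (real r')\<^sup>2 / 4 ^ k) * real r"
proof -
  define P where "P = proj_kernel r E"
  define P' where "P' = proj_kernel r' E'"
  \<comment> \<open>The normalised trace of \<open>P'\<close>, so that \<open>Q\<close> has trace
    zero and the contraction applies to it.\<close>
  define c where "c = complex_of_real (real r' / 4 ^ k)"
  define Q where "Q x y = P' x y - c * id_kernel x y" for x y
  \<comment> \<open>The conjugated projection is tested on \<open>E i\<close>. This moves the
    unitary to \<open>E i\<close>, giving \<open>v\<close>, which \<open>P'\<close> fixes and which
    has the norm of \<open>E i\<close>, namely 1.\<close>
  have one: "(\<Sum>x\<in>words k. \<Sum>y\<in>words k. word_pull w P' x y * (cnj (E i x) * E i y)) = 1"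
    if w: "w \<in> set (List.n_lists t gens)" and i: "i < r" for w i
  proof -
    from V[OF w i] obtain v where v1: "\<And>x. x \<in> words k \<Longrightarrow> v (word_perm w x) = sign_of (word_sign w x) * E i x"
      and v2: "\<And>x. x \<in> words k \<Longrightarrow> v x = (\<Sum>j<r'. (\<Sum>y\<in>words k. v y * cnj (E' j y)) * E' j x)"
      by blast
    have Pv: "(\<Sum>y\<in>words k. P' x y * v y) = v x" if "x \<in> words k" for x
    proof -
      have "(\<Sum>y\<in>words k. P' x y * v y) = (\<Sum>y\<in>words k. \<Sum>j<r'. v y * cnj (E' j y) * E' j x)"
        unfolding P'_def proj_kernel_def sum_distrib_right by (intro sum.cong refl) (simp add: mult_ac)
      also have "\<dots> = (\<Sum>j<r'. (\<Sum>y\<in>words k. v y * cnj (E' j y)) * E' j x)"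
        by (subst sum.swap) (simp add: sum_distrib_right)
      finally show ?thesis using v2[OF that] by simp
    qed
    have "(\<Sum>x\<in>words k. \<Sum>y\<in>words k. word_pull w P' x y * (cnj (E i x) * E i y)) =
        (\<Sum>x\<in>words k. \<Sum>y\<in>words k. cnj (v (word_perm w x)) * (P' (word_perm w x) (word_perm w y) * v (word_perm w y)))"
      by (intro sum.cong refl) (simp add: word_pull_def v1 mult_ac)
    also have "\<dots> = (\<Sum>x\<in>words k. \<Sum>y\<in>words k. cnj (v (word_perm w x)) * (P' (word_perm w x) y * v y))"
    proof (rule sum.cong[OF refl])
      fix x
      show "(\<Sum>y\<in>words k. cnj (v (word_perm w x)) * (P' (word_perm w x) (word_perm w y) * v (word_perm w y))) =
          (\<Sum>y\<in>words k. cnj (v (word_perm w x)) * (P' (word_perm w x) y * v y))"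
        by (rule sum.reindex_bij_betw[OF bij_word_perm, where g = "\<lambda>y. cnj (v (word_perm w x)) * (P' (word_perm w x) y * v y)"])
    qed
    also have "\<dots> = (\<Sum>x\<in>words k. \<Sum>y\<in>words k. cnj (v x) * (P' x y * v y))"
      by (rule sum.reindex_bij_betw[OF bij_word_perm, where g = "\<lambda>x. \<Sum>y\<in>words k. cnj (v x) * (P' x y * v y)"])
    also have "\<dots> = (\<Sum>x\<in>words k. cnj (v x) * v x)"
      by (simp add: sum_distrib_left[symmetric] Pv)
    also have "\<dots> = (\<Sum>x\<in>words k. cnj (v (word_perm w x)) * v (word_perm w x))"
      by (rule sum.reindex_bij_betw[OF bij_word_perm, symmetric])
    also have "\<dots> = (\<Sum>x\<in>words k. E i x * cnj (E i x))"
      by (intro sum.cong refl) (auto simp: v1 sign_of_def)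
    also have "\<dots> = 1" using E i by (simp add: orthonormal_def)
    finally show ?thesis .
  qed
  have trP: "mtrace k P = of_nat r" "mtrace k P' = of_nat r'"
    using E E' by (simp_all add: P_def P'_def mtrace_proj_kernel)
  have trQ: "mtrace k Q = 0"
    using trP by (simp add: Q_def mtrace_def sum_subtractf id_kernel_def card_words c_def)
  have "frob_inner k (word_pull w Q) P = of_nat r - c * of_nat r" if "w \<in> set (List.n_lists t gens)" for w
  proof -
    have "frob_inner k (word_pull w Q) P = frob_inner k (word_pull w P') P - c * frob_inner k id_kernel P"
      by (simp add: Q_def[abs_def] word_pull_diff_id_kernel frob_inner_diff_left)
    also have "frob_inner k (word_pull w P') P = of_nat r"
      by (simp add: P_def frob_inner_proj_kernel_right one[OF that])
    finally show ?thesis by (simp add: frob_inner_id_kernel_left trP)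
  qed
  then have inner: "frob_inner k ((gen_avg ^^ t) Q) P = of_nat r - c * of_nat r"
    by (rule frob_inner_gen_avg_power)
  \<comment> \<open>Having trace zero, \<open>Q\<close> is orthogonal to the identity, so its
    squared norm is that of \<open>P'\<close>, which is \<open>r'\<close>, minus \<open>c\<close>
    times the trace of \<open>P'\<close>.\<close>
  have "frob_inner k Q Q = frob_inner k P' Q - c * frob_inner k id_kernel Q"
    by (simp add: Q_def[abs_def] frob_inner_diff_left)
  also have "frob_inner k id_kernel Q = 0" by (simp add: frob_inner_id_kernel_left trQ)
  also have "frob_inner k P' Q = cnj (frob_inner k P' P' - c * frob_inner k id_kernel P')"
    by (subst frob_inner_commute) (simp add: Q_def[abs_def] frob_inner_diff_left)
  also have "\<dots> = of_nat r' - c * of_nat r'"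
    using E' by (simp add: frob_inner_id_kernel_left trP frob_sq_frob_inner[symmetric] frob_sq_proj_kernel P'_def[symmetric] c_def)
      (simp add: P'_def frob_sq_proj_kernel)
  finally have "complex_of_real (frob_sq k Q) = complex_of_real (real r' - (real r')\<^sup>2 / 4 ^ k)"
    by (simp add: frob_sq_frob_inner c_def power2_eq_square)
  then have nrmQ: "frob_sq k Q = real r' - (real r')\<^sup>2 / 4 ^ k" by (simp only: of_real_eq_iff)
  have "of_nat r - c * of_nat r = complex_of_real (real r - real r' / 4 ^ k * real r)"
    by (simp add: c_def)
  then have "(real r - real r' / 4 ^ k * real r)\<^sup>2 = (cmod (frob_inner k ((gen_avg ^^ t) Q) P))\<^sup>2"
    unfolding inner by (simp only: norm_of_real power2_abs)
  also have "\<dots> \<le> frob_sq k ((gen_avg ^^ t) Q) * frob_sq k P"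
    by (rule frob_inner_Cauchy_Schwarz)
  also have "\<dots> \<le> (1 - 1 / 5000) ^ t * frob_sq k Q * frob_sq k P"
    by (intro mult_right_mono frob_sq_gen_avg_power_le trQ) (simp add: frob_sq_def sum_nonneg)
  finally show ?thesis
    using E by (simp add: nrmQ P_def frob_sq_proj_kernel)
qed

text \<open>Cancelling \<open>r * (n - r')\<close> leaves
  \<open>r * (n - r') \<le> \<nu> * r' * n\<close>. With \<open>r \<le> n / 2\<close> this gives
  \<open>r \<le> r' * (1 / 2 + \<nu>)\<close>, and \<open>\<nu> \<le> lam / 4\<close> is what makes
  \<open>(2 - lam) * (1 / 2 + \<nu>)\<close> at most 1.\<close>

lemma expansion_bound:
  fixes r r' n \<nu> lam :: real
  assumes "(r - r' / n * r)\<^sup>2 \<le> \<nu> * (r' - r'\<^sup>2 / n) * r"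
    and "0 \<le> r" "0 < n" "r \<le> n / 2" "0 \<le> r'" "r' \<le> n" "0 < \<nu>" "\<nu> \<le> lam / 4" "0 < lam"
  shows "(2 - lam) * r \<le> r'"
proof (cases "r = 0 \<or> r' = n \<or> lam \<ge> 2")
  case True
  then show ?thesis
  proof (elim disjE)
    assume "r' = n"
    have "(2 - lam) * r \<le> 2 * r" using assms by (intro mult_right_mono) auto
    with assms \<open>r' = n\<close> show ?thesis by simp
  next
    assume "lam \<ge> 2"
    then have "(2 - lam) * r \<le> 0" using assms by (simp add: mult_nonpos_nonneg)
    with assms show ?thesis by simp
  qed (use assms in auto)
next
  case False
  then have pos: "r > 0" "n - r' > 0" "lam < 2" using assms by auto
  have "(r - r' / n * r)\<^sup>2 = (r * (n - r')) * (r * (n - r')) / n\<^sup>2"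
    using assms by (simp add: field_simps power2_eq_square)
  moreover have "\<nu> * (r' - r'\<^sup>2 / n) * r = (r * (n - r')) * (\<nu> * r' * n) / n\<^sup>2"
    using assms by (simp add: field_simps power2_eq_square)
  ultimately have "(r * (n - r')) * (r * (n - r')) \<le> (r * (n - r')) * (\<nu> * r' * n)"
    using assms by (simp add: divide_le_cancel)
  then have "r * (n - r') \<le> \<nu> * r' * n" using pos by simp
  then have "r * n \<le> r' * r + \<nu> * r' * n" by (simp add: algebra_simps)
  also have "\<dots> \<le> r' * (n / 2) + \<nu> * r' * n"
    using assms by (intro add_right_mono mult_left_mono) auto
  also have "\<dots> = (r' * (1 / 2 + \<nu>)) * n" by (simp add: algebra_simps)
  finally have "r \<le> r' * (1 / 2 + \<nu>)" using assms by simp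
  then have "(2 - lam) * r \<le> (2 - lam) * (r' * (1 / 2 + \<nu>))"
    using pos by (intro mult_left_mono) auto
  also have "\<dots> = r' * (1 + 2 * \<nu> - lam / 2 - lam * \<nu>)" by (simp add: field_simps)
  also have "\<dots> \<le> r' * 1"
  proof (intro mult_left_mono)
    have "0 \<le> lam * \<nu>" using assms by simp
    then show "1 + 2 * \<nu> - lam / 2 - lam * \<nu> \<le> 1"
      using \<open>\<nu> \<le> lam / 4\<close> by linarith
  qed (use assms in auto)
  finally show ?thesis by simp
qed

section \<open>From operators to dimensions\<close>

context cof_vec_space
begin

text \<open>Gram-Schmidt needs a finite basis to start from. Independent subsets of \<open>W\<close>
  have at most \<open>n\<close> elements, so a maximal one exists, and it spans
  \<open>W\<close>.\<close>

lemma subspace_orthogonal_basis: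
  assumes W: "VectorSpace.subspace class_ring W V"
  obtains us where "set us \<subseteq> W" "W = span (set us)" "corthogonal us"
    "length us = vectorspace.dim class_ring (vs W)" "set us \<subseteq> carrier_vec n" "length us \<le> n"
proof -
  have sub: "submodule class_ring W V" using W by (simp add: subspace_def)
  have Wc: "W \<subseteq> carrier_vec n" using submodule.subset[OF sub] by simp
  interpret U: vectorspace class_ring "vs W" using subspace_is_vs[OF W] .
  have li: "U.lin_dep S \<longleftrightarrow> lin_dep S" and sp: "U.span S = span S" if "S \<subseteq> W" for S
    using span_li_not_depend[OF that sub] by auto
  have bnd: "finite S \<and> card S \<le> n" if "S \<subseteq> carrier (vs W) \<and> U.lin_indpt S" for S
    using that li[of S] li_le_dim[of S] Wc by (auto simp: dim_is_n)
  have "{} \<subseteq> carrier (vs W) \<and> U.lin_indpt {}"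
    by (auto simp: U.lin_dep_def)
  from maximal_exists[of "\<lambda>S. S \<subseteq> carrier (vs W) \<and> U.lin_indpt S", OF bnd this]
  obtain B where B: "finite B" "maximal B (\<lambda>S. S \<subseteq> carrier (vs W) \<and> U.lin_indpt S)" by blast
  have Bb: "U.basis B" by (rule U.max_li_is_basis[OF B(2)])
  then have BW: "B \<subseteq> W" and Bs: "span B = W" and Bli: "lin_indpt B"
    using li[of B] sp[of B] by (auto simp: U.basis_def)
  obtain ws where ws: "set ws = B" "distinct ws" using finite_distinct_list[OF B(1)] by blast
  note gs = gram_schmidt_result[of ws "gram_schmidt n ws", OF _ ws(2)]
  have c: "set ws \<subseteq> carrier_vec n" "lin_indpt (set ws)" using ws BW Wc Bli by auto
  show ?thesis
  proof (rule that)
    have sp': "span (set (gram_schmidt n ws)) = W" using gs(1)[OF c refl] Bs ws by simp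
    show "W = span (set (gram_schmidt n ws))" using sp' by simp
    show "set (gram_schmidt n ws) \<subseteq> W"
      using in_own_span[of "set (gram_schmidt n ws)"] gs(3)[OF c refl] sp' by simp
    show "corthogonal (gram_schmidt n ws)" by (rule gs(2)[OF c refl])
    show "length (gram_schmidt n ws) = vectorspace.dim class_ring (vs W)"
      using gs(4)[OF c refl] U.dim_basis[OF B(1) Bb] ws distinct_card[of ws] by simp
    show "set (gram_schmidt n ws) \<subseteq> carrier_vec n" by (rule gs(3)[OF c refl])
    show "length (gram_schmidt n ws) \<le> n"
      using gs(4)[OF c refl] bnd[of B] B(2) ws distinct_card[of ws] by (simp add: maximal_def)
  qed
qed

end

text \<open>Gram-Schmidt leaves the vectors unnormalised, so each is divided by its norm
  \<open>m i\<close>. The last property says that the orthogonal projection fixes the vectors of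
  \<open>W\<close>, the form in which \<open>expansion_core\<close> expects membership in a
  span.\<close>

lemma subspace_orthonormal_functions:
  fixes n :: nat and W :: "complex vec set"
  assumes W: "VectorSpace.subspace class_ring W (module_vec TYPE(complex) n)"
  obtains e :: "nat \<Rightarrow> nat \<Rightarrow> complex" and r where
    "r = vectorspace.dim class_ring ((module_vec TYPE(complex) n)\<lparr>carrier := W\<rparr>)" "r \<le> n"
    "\<And>i j. i < r \<Longrightarrow> j < r \<Longrightarrow> (\<Sum>a<n. e i a * cnj (e j a)) = (if i = j then 1 else 0)"
    "\<And>i. i < r \<Longrightarrow> vec n (e i) \<in> W"
    "\<And>v a. v \<in> W \<Longrightarrow> a < n \<Longrightarrow> v $ a = (\<Sum>i<r. (\<Sum>b<n. v $ b * cnj (e i b)) * e i a)"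
proof -
  interpret cof_vec_space n "TYPE(complex)" .
  obtain us where us: "set us \<subseteq> W" "W = span (set us)" "corthogonal us"
    "length us = vectorspace.dim class_ring (vs W)" "set us \<subseteq> carrier_vec n" "length us \<le> n"
    by (rule subspace_orthogonal_basis[OF W])
  define r where "r = length us"
  define m where "m i = sqrt (\<Sum>a<n. (cmod (us ! i $ a))\<^sup>2)" for i
  define e where "e i a = us ! i $ a / complex_of_real (m i)" for i a
  have dim: "dim_vec (us ! i) = n" if "i < r" for i
    using subsetD[OF us(5) nth_mem, of i] that by (simp add: r_def)
  have sp: "us ! i \<bullet>c us ! j = (\<Sum>a<n. us ! i $ a * cnj (us ! j $ a))" if "i < r" "j < r" for i j
    using that dim by (simp add: scalar_prod_def atLeast0LessThan)
  have sq: "(\<Sum>a<n. us ! i $ a * cnj (us ! i $ a)) = complex_of_real ((m i)\<^sup>2)" for i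
    by (simp add: m_def sum_nonneg complex_norm_square[symmetric] del: of_real_power) 
  have mnz: "m i \<noteq> 0" if "i < r" for i
    using corthogonalD[OF us(3), of i i] that sp[OF that that] sq[of i] by (auto simp: r_def)
  have on: "(\<Sum>a<n. e i a * cnj (e j a)) = (if i = j then 1 else 0)" if "i < r" "j < r" for i j
  proof -
    have "(\<Sum>a<n. e i a * cnj (e j a)) = (us ! i \<bullet>c us ! j) / (m i * m j)"
      by (simp add: sp that e_def sum_divide_distrib)
    also have "\<dots> = (if i = j then 1 else 0)"
      using corthogonalD[OF us(3), of i j] that mnz[of i] sp[of i i] sq[of i]
      by (auto simp: r_def power2_eq_square)
    finally show ?thesis .
  qed
  have inW: "vec n (e i) \<in> W" if "i < r" for i
  proof -
    have "us ! i \<in> W" using us(1) that by (auto simp: r_def)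
    moreover have "submodule class_ring W V" using W by (simp add: subspace_def)
    ultimately have "(1 / complex_of_real (m i)) \<cdot>\<^sub>v us ! i \<in> W"
      using submodule.smult_closed[of class_ring W V] by simp
    moreover have "(1 / complex_of_real (m i)) \<cdot>\<^sub>v us ! i = vec n (e i)"
      by (rule eq_vecI) (use dim[OF that] in \<open>auto simp: e_def\<close>)
    ultimately show ?thesis by simp
  qed
  have exp: "v $ a = (\<Sum>i<r. (\<Sum>b<n. v $ b * cnj (e i b)) * e i a)" if "v \<in> W" "a < n" for v a
  proof -
    from that us(2) obtain c where c: "v = lincomb c (set us)"
      using finite_in_span[OF finite_set us(5)] by blast
    have inj: "bij_betw (nth us) {..<r} (set us)"
      unfolding r_def by (rule bij_betw_nth[OF corthogonal_distinct[OF us(3)]]) auto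
    define d where "d i = c (us ! i) * m i" for i
    have v: "v $ b = (\<Sum>i<r. d i * e i b)" if "b < n" for b
    proof -
      have "v $ b = (\<Sum>u\<in>set us. c u * u $ b)"
        unfolding c by (rule lincomb_index[OF that us(5)])
      also have "\<dots> = (\<Sum>i<r. c (us ! i) * us ! i $ b)"
        by (rule sum.reindex_bij_betw[OF inj, symmetric])
      also have "\<dots> = (\<Sum>i<r. d i * e i b)"
        by (intro sum.cong refl) (use mnz in \<open>auto simp: d_def e_def\<close>)
      finally show ?thesis .
    qed
    have "(\<Sum>b<n. v $ b * cnj (e i b)) = d i" if "i < r" for i
    proof -
      have "(\<Sum>b<n. v $ b * cnj (e i b)) = (\<Sum>b<n. \<Sum>j<r. d j * (e j b * cnj (e i b)))"
        by (intro sum.cong refl) (simp add: v sum_distrib_right mult.assoc)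
      also have "\<dots> = (\<Sum>j<r. d j * (\<Sum>b<n. e j b * cnj (e i b)))"
        by (subst sum.swap) (simp add: sum_distrib_left)
      also have "\<dots> = (\<Sum>j<r. if j = i then d j else 0)"
        by (intro sum.cong refl) (simp add: on that)
      finally show ?thesis using that by simp
    qed
    then show ?thesis using v[OF \<open>a < n\<close>] by simp
  qed
  show ?thesis
  proof (rule that)
    show "r = vectorspace.dim class_ring (vs W)" "r \<le> n" using us(4,6) by (simp_all add: r_def)
  qed (fact on inW exp)+
qed

text \<open>The first block varies fastest, so that consecutive words differ by an increment of a base 4
  counter with the least significant digit on top of its stack.\<close>

fun word_list :: "nat \<Rightarrow> sym list list" where
  "word_list 0 = [[]]"
| "word_list (Suc k) = concat (map (\<lambda>w. map (\<lambda>c. c # w) [Zero, One, Minus, Sep]) (word_list k))"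

lemma set_word_list: "set (word_list k) = words k"
  by (induction k) (auto simp: words_0 words_Suc UNIV_sym)

lemma length_word_list: "length (word_list k) = 4 ^ k"
  by (induction k) (simp_all add: length_concat comp_def sum_list_triv)

lemma distinct_word_list: "distinct (word_list k)"
  by (rule card_distinct) (simp add: set_word_list card_words length_word_list)

lemma bij_word_list: "bij_betw (nth (word_list k)) {..<4 ^ k} (words k)"
  by (rule bij_betw_nth[OF distinct_word_list]) (simp_all add: length_word_list set_word_list)

section \<open>Matrices of words of generators\<close>

definition entry :: "gen list \<Rightarrow> sym list \<Rightarrow> sym list \<Rightarrow> int" where
  "entry w x y = (if word_perm w y = x then if word_sign w y then -1 else 1 else 0)"

definition word_mat :: "nat \<Rightarrow> gen list \<Rightarrow> complex mat" where
  "word_mat k w = mat (4 ^ k) (4 ^ k) (\<lambda>(a, b). of_int (entry w (word_list k ! a) (word_list k ! b)))"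

lemma word_mat_carrier: "word_mat k w \<in> carrier_mat (4 ^ k) (4 ^ k)"
  by (simp add: word_mat_def)

definition word_index :: "nat \<Rightarrow> sym list \<Rightarrow> nat" where
  "word_index k = the_inv_into {..<4 ^ k} (nth (word_list k))"

lemma word_index_nth: "a < 4 ^ k \<Longrightarrow> word_index k (word_list k ! a) = a"
  unfolding word_index_def
  by (rule the_inv_into_f_f) (use bij_word_list[of k] in \<open>auto simp: bij_betw_def\<close>)

lemma word_index: "x \<in> words k \<Longrightarrow> word_index k x < 4 ^ k \<and> word_list k ! word_index k x = x"
proof -
  assume "x \<in> words k"
  then obtain a where "a < 4 ^ k" "x = word_list k ! a"
    using bij_word_list[of k] unfolding bij_betw_def by auto
  then show ?thesis using word_index_nth[of a k] by simp
qed

lemma sum_word_list: "(\<Sum>a<4 ^ k. f (word_list k ! a)) = (\<Sum>x\<in>words k. f x)"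
  by (rule sum.reindex_bij_betw[OF bij_word_list])

lemma word_perm_words: "x \<in> words k \<Longrightarrow> word_perm w x \<in> words k"
  by (simp add: words_def)

text \<open>The row of \<open>word_perm w x\<close> has its only nonzero entry in the column of
  \<open>x\<close>, because \<open>word_perm w\<close> is injective. The equation is the condition
  that \<open>expansion_core\<close> puts on an image vector.\<close>

lemma word_mat_mult_vec:
  assumes v: "v \<in> carrier_vec (4 ^ k)" and x: "x \<in> words k"
  shows "(word_mat k w *\<^sub>v v) $ word_index k (word_perm w x) = sign_of (word_sign w x) * v $ word_index k x"
proof -
  let ?a = "word_index k (word_perm w x)"
  have a: "?a < 4 ^ k" "word_list k ! ?a = word_perm w x"
    using word_index[OF word_perm_words[OF x]] by auto
  have "(word_mat k w *\<^sub>v v) $ ?a = (\<Sum>b<4 ^ k. of_int (entry w (word_perm w x) (word_list k ! b)) * v $ b)"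
    using a v by (simp add: word_mat_def scalar_prod_def atLeast0LessThan)
  also have "\<dots> = (\<Sum>b<4 ^ k. of_int (entry w (word_perm w x) (word_list k ! b)) * v $ word_index k (word_list k ! b))"
    by (intro sum.cong refl) (simp add: word_index_nth)
  also have "\<dots> = (\<Sum>y\<in>words k. of_int (entry w (word_perm w x) y) * v $ word_index k y)"
    by (rule sum_word_list)
  also have "\<dots> = (\<Sum>y\<in>words k. if y = x then sign_of (word_sign w x) * v $ word_index k x else 0)"
    by (intro sum.cong refl) (auto simp: entry_def sign_of_def dest: word_perm_inj)
  also have "\<dots> = sign_of (word_sign w x) * v $ word_index k x" using x by simp
  finally show ?thesis .
qed

text \<open>\<open>W'\<close> may be any subspace containing the images; the sum of subspaces is
  inserted later. The proof transports both orthonormal bases to functions on words along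
  \<open>word_index\<close>.\<close>

lemma word_mat_expansion:
  fixes k t :: nat
  defines "n \<equiv> (4 :: nat) ^ k" and "VS \<equiv> module_vec TYPE(complex) (4 ^ k)"
  assumes W: "VectorSpace.subspace class_ring W VS" and W': "VectorSpace.subspace class_ring W' VS"
    and maps: "\<And>w v. w \<in> set (List.n_lists t gens) \<Longrightarrow> v \<in> W \<Longrightarrow> word_mat k w *\<^sub>v v \<in> W'"
    and small: "real (vectorspace.dim class_ring (VS\<lparr>carrier := W\<rparr>)) \<le> 4 ^ k / 2"
    and lam: "0 < lam" "(1 - 1 / 5000) ^ t \<le> lam / 4"
  shows "(2 - lam) * real (vectorspace.dim class_ring (VS\<lparr>carrier := W\<rparr>)) \<le>
    real (vectorspace.dim class_ring (VS\<lparr>carrier := W'\<rparr>))"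
proof -
  have orth: "orthonormal k r (\<lambda>i x. e i (word_index k x))"
    if "\<And>i j. i < r \<Longrightarrow> j < r \<Longrightarrow> (\<Sum>a<n. e i a * cnj (e j a)) = (if i = j then 1 else 0)" for r e
    unfolding orthonormal_def
  proof (intro allI impI)
    fix i j assume ij: "i < r" "j < r"
    have "(\<Sum>x\<in>words k. e i (word_index k x) * cnj (e j (word_index k x))) =
        (\<Sum>a<4 ^ k. e i (word_index k (word_list k ! a)) * cnj (e j (word_index k (word_list k ! a))))"
      by (rule sum_word_list[symmetric])
    also have "\<dots> = (\<Sum>a<n. e i a * cnj (e j a))"
      unfolding n_def by (intro sum.cong refl) (simp add: word_index_nth)
    finally show "(\<Sum>x\<in>words k. e i (word_index k x) * cnj (e j (word_index k x))) = (if i = j then 1 else 0)"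
      using that[OF ij] by simp
  qed
  obtain e r where e: "r = vectorspace.dim class_ring (VS\<lparr>carrier := W\<rparr>)"
    "\<And>i j. i < r \<Longrightarrow> j < r \<Longrightarrow> (\<Sum>a<n. e i a * cnj (e j a)) = (if i = j then 1 else (0 :: complex))"
    "\<And>i. i < r \<Longrightarrow> vec n (e i) \<in> W"
    using W unfolding VS_def n_def by (rule subspace_orthonormal_functions) blast
  obtain e' r' where e': "r' = vectorspace.dim class_ring (VS\<lparr>carrier := W'\<rparr>)" "r' \<le> n"
    "\<And>i j. i < r' \<Longrightarrow> j < r' \<Longrightarrow> (\<Sum>a<n. e' i a * cnj (e' j a)) = (if i = j then 1 else (0 :: complex))"
    "\<And>v a. v \<in> W' \<Longrightarrow> a < n \<Longrightarrow> v $ a = (\<Sum>i<r'. (\<Sum>b<n. v $ b * cnj (e' i b)) * e' i a)"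
    using W' unfolding VS_def n_def by (rule subspace_orthonormal_functions) blast
  have core: "(real r - real r' / 4 ^ k * real r)\<^sup>2 \<le>
    (1 - 1 / 5000) ^ t * (real r' - (real r')\<^sup>2 / 4 ^ k) * real r"
  proof (rule expansion_core[OF orth[OF e(2)] orth[OF e'(3)]])
    fix w i assume w: "w \<in> set (List.n_lists t gens)" and i: "i < r"
    define u where "u = word_mat k w *\<^sub>v vec n (e i)"
    have u: "u \<in> W'" unfolding u_def by (rule maps[OF w e(3)[OF i]])
    show "\<exists>v. (\<forall>x\<in>words k. v (word_perm w x) = sign_of (word_sign w x) * e i (word_index k x)) \<and>
        (\<forall>x\<in>words k. v x = (\<Sum>j<r'. (\<Sum>y\<in>words k. v y * cnj (e' j (word_index k y))) * e' j (word_index k x)))"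
    proof (intro exI[of _ "\<lambda>x. u $ word_index k x"] conjI ballI)
      fix x assume x: "x \<in> words k"
      show "u $ word_index k (word_perm w x) = sign_of (word_sign w x) * e i (word_index k x)"
        using word_mat_mult_vec[of "vec n (e i)" k x w] x word_index[OF x] by (simp add: u_def n_def)
      have "(\<Sum>y\<in>words k. u $ word_index k y * cnj (e' j (word_index k y))) =
          (\<Sum>b<n. u $ b * cnj (e' j b))" for j
      proof -
        have "(\<Sum>y\<in>words k. u $ word_index k y * cnj (e' j (word_index k y))) =
          (\<Sum>b<4 ^ k. u $ word_index k (word_list k ! b) * cnj (e' j (word_index k (word_list k ! b))))"
          by (rule sum_word_list[symmetric])
        then show ?thesis unfolding n_def by (simp add: word_index_nth)
      qed
      then show "u $ word_index k x =
          (\<Sum>j<r'. (\<Sum>y\<in>words k. u $ word_index k y * cnj (e' j (word_index k y))) * e' j (word_index k x))"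
        using e'(4)[OF u, of "word_index k x"] word_index[OF x] by (simp add: n_def)
    qed
  qed
  have r'n: "real r' \<le> 4 ^ k"
    using of_nat_mono[OF e'(2), where 'a = real] by (simp add: n_def)
  show ?thesis
    unfolding e(1)[symmetric] e'(1)[symmetric]
    by (rule expansion_bound[OF core]) (use small e(1) r'n lam in auto)
qed


lemma dimension_expander_word_mat:
  assumes lam: "0 < lam" "(1 - 1 / 5000) ^ t \<le> lam / 4"
  shows "vectorspace.dimension_expander class_ring (module_vec TYPE(complex) (4 ^ k))
    (length (List.n_lists t gens)) (\<lambda>i v. word_mat k (List.n_lists t gens ! i) *\<^sub>v v) (1 - lam) (1 / 2 - lam)"
proof -
  define n :: nat where "n = 4 ^ k"
  define d where "d = length (List.n_lists t gens)"
  define T where "T i = word_mat k (List.n_lists t gens ! i)" for i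
  interpret cof_vec_space n "TYPE(complex)" .
  have T: "T i \<in> carrier_mat n n" for i by (simp add: T_def n_def word_mat_carrier)
  have Tadd: "T i *\<^sub>v (v + w) = T i *\<^sub>v v + T i *\<^sub>v w" if "v \<in> carrier_vec n" "w \<in> carrier_vec n" for i v w
    by (rule mult_add_distrib_mat_vec[OF T that])
  have Tsm: "T i *\<^sub>v (c \<cdot>\<^sub>v v) = c \<cdot>\<^sub>v (T i *\<^sub>v v)" if "v \<in> carrier_vec n" for i v c
    by (rule mult_mat_vec[OF T that])
  have Tcl: "T i *\<^sub>v v \<in> carrier_vec n" if "v \<in> carrier_vec n" for i v
    using mult_mat_vec_carrier[OF T that] .
  have T0: "T i *\<^sub>v 0\<^sub>v n = 0\<^sub>v n" for i
    using Tsm[of "0\<^sub>v n" i 0] Tcl[of "0\<^sub>v n" i] by simp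
  have "vectorspace.dimension_expander class_ring V d (\<lambda>i v. T i *\<^sub>v v) (1 - lam) (1 / 2 - lam)"
    unfolding dimension_expander_def
  proof (intro conjI allI impI)
    show fin_dim by simp
    show "linear_map class_ring V V (\<lambda>v. T i *\<^sub>v v)" for i
      unfolding linear_map_def mod_hom_def mod_hom_axioms_def LinearCombinations.module_hom_def
      using Tadd Tsm Tcl vec_vs vec_module by auto
    fix W assume "VectorSpace.subspace class_ring W V \<and>
      real (vectorspace.dim class_ring (vs W)) \<le> (1 / 2 - lam) * real dim"
    then have W: "VectorSpace.subspace class_ring W V"
      and small: "real (vectorspace.dim class_ring (vs W)) \<le> (1 / 2 - lam) * real n" by (auto simp: dim_is_n)
    have subW: "submodule class_ring W V" using W by (simp add: subspace_def)
    have Wc: "W \<subseteq> carrier_vec n" using submodule.subset[OF subW] by simp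
    have Wadd: "v + w \<in> W" if "v \<in> W" "w \<in> W" for v w using submodule.m_closed[OF subW that] by simp
    have Wsm: "c \<cdot>\<^sub>v v \<in> W" if "v \<in> W" for c v using submodule.smult_closed[OF subW _ that, of c] by simp
    have W0: "0\<^sub>v n \<in> W" using submodule.zero_closed[OF subW] by simp
    define s where "s w u = w + finsum V (\<lambda>i. T i *\<^sub>v u i) {..<d}" for w u
    define S where "S = {s w u | w u. w \<in> W \<and> (\<forall>i<d. u i \<in> W)}"
    have fc: "(\<lambda>i. T i *\<^sub>v u i) \<in> {..<d} \<rightarrow> carrier_vec n" if "\<forall>i<d. u i \<in> W" for u
      using that Wc Tcl by auto
    have sc: "s w u \<in> carrier_vec n" if "w \<in> W" "\<forall>i<d. u i \<in> W" for w u
      unfolding s_def using that Wc finsum_closed[OF fc[OF that(2)]] by auto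
    have s_add: "s w u + s w' u' = s (w + w') (\<lambda>i. u i + u' i)"
      if "w \<in> W" "\<forall>i<d. u i \<in> W" "w' \<in> W" "\<forall>i<d. u' i \<in> W" for w u w' u'
    proof -
      have "finsum V (\<lambda>i. T i *\<^sub>v (u i + u' i)) {..<d} = finsum V (\<lambda>i. T i *\<^sub>v u i + T i *\<^sub>v u' i) {..<d}"
      proof (rule finsum_cong')
        have uc: "u i \<in> carrier_vec n" "u' i \<in> carrier_vec n" if "i < d" for i
          using \<open>\<forall>i<d. u i \<in> W\<close> \<open>\<forall>i<d. u' i \<in> W\<close> that Wc by auto
        show "(\<lambda>i. T i *\<^sub>v u i + T i *\<^sub>v u' i) \<in> {..<d} \<rightarrow> carrier_vec n"
          by (auto simp: uc Tcl)
        show "T i *\<^sub>v (u i + u' i) = T i *\<^sub>v u i + T i *\<^sub>v u' i" if "i \<in> {..<d}" for i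
          using that by (simp add: uc Tadd)
      qed simp
      also have "\<dots> = finsum V (\<lambda>i. T i *\<^sub>v u i) {..<d} + finsum V (\<lambda>i. T i *\<^sub>v u' i) {..<d}"
        using finsum_addf[OF fc[OF that(2)] fc[OF that(4)]] by simp
      finally show ?thesis
        using that Wc finsum_closed[OF fc[OF that(2)]] finsum_closed[OF fc[OF that(4)]]
        unfolding s_def by (intro eq_vecI) auto
    qed
    have s_sm: "c \<cdot>\<^sub>v s w u = s (c \<cdot>\<^sub>v w) (\<lambda>i. c \<cdot>\<^sub>v u i)" if "w \<in> W" "\<forall>i<d. u i \<in> W" for c w u
    proof -
      have "finsum V (\<lambda>i. T i *\<^sub>v (c \<cdot>\<^sub>v u i)) {..<d} = finsum V (\<lambda>i. c \<cdot>\<^sub>v (T i *\<^sub>v u i)) {..<d}"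
        by (rule finsum_cong') (use that Wc Tcl Tsm in auto)
      also have "\<dots> = c \<cdot>\<^sub>v finsum V (\<lambda>i. T i *\<^sub>v u i) {..<d}"
        using finsum_smult[OF _ fc[OF that(2)], of c] by simp
      finally show ?thesis
        using smult_add_distrib_vec[OF subsetD[OF Wc that(1)] finsum_closed[OF fc[OF that(2)]], of c]
        unfolding s_def by simp
    qed
    have subS: "submodule class_ring S V"
    proof
      show "S \<subseteq> carrier V" using sc by (auto simp: S_def)
      show "v \<oplus>\<^bsub>V\<^esub> w \<in> S" if "v \<in> S" "w \<in> S" for v w
      proof -
        from that obtain a u a' u' where "v = s a u" "a \<in> W" "\<forall>i<d. u i \<in> W"
          "w = s a' u'" "a' \<in> W" "\<forall>i<d. u' i \<in> W" by (auto simp: S_def)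
        then have "v \<oplus>\<^bsub>V\<^esub> w = s (a + a') (\<lambda>i. u i + u' i)" "a + a' \<in> W" "\<forall>i<d. u i + u' i \<in> W"
          using s_add Wadd by auto
        then show ?thesis unfolding S_def by blast
      qed
      show "c \<odot>\<^bsub>V\<^esub> v \<in> S" if "c \<in> carrier class_ring" "v \<in> S" for c v
      proof -
        from that obtain a u where "v = s a u" "a \<in> W" "\<forall>i<d. u i \<in> W" by (auto simp: S_def)
        then have "c \<odot>\<^bsub>V\<^esub> v = s (c \<cdot>\<^sub>v a) (\<lambda>i. c \<cdot>\<^sub>v u i)" "c \<cdot>\<^sub>v a \<in> W" "\<forall>i<d. c \<cdot>\<^sub>v u i \<in> W"
          using s_sm Wsm by auto
        then show ?thesis unfolding S_def by blast
      qed
      have "s (0\<^sub>v n) (\<lambda>i. 0\<^sub>v n) = 0\<^sub>v n"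
        using s_sm[of "0\<^sub>v n" "\<lambda>i. 0\<^sub>v n" 0] W0 sc[of "0\<^sub>v n" "\<lambda>i. 0\<^sub>v n"] by simp
      then show "\<zero>\<^bsub>V\<^esub> \<in> S" using W0 unfolding S_def by force
    qed
    have TW: "T i *\<^sub>v v \<in> S" if i: "i < d" and v: "v \<in> W" for i v
    proof -
      \<comment> \<open>Placing \<open>v\<close> at position \<open>i\<close> and zero elsewhere
        exhibits a single image as a member of the sum.\<close>
      define u where "u j = (if j = i then v else 0\<^sub>v n)" for j
      have u: "\<forall>j<d. u j \<in> W" using v W0 by (simp add: u_def)
      have "finsum V (\<lambda>j. T j *\<^sub>v u j) {..<d} = finsum V (\<lambda>j. if i = j then T j *\<^sub>v v else 0\<^sub>v n) {..<d}"
        by (rule finsum_cong') (use v Wc Tcl T0 in \<open>auto simp: u_def\<close>)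
      also have "\<dots> = T i *\<^sub>v v"
        using finsum_singleton[of i "{..<d}" "\<lambda>j. T j *\<^sub>v v"] i subsetD[OF Wc v] Tcl by auto
      finally have "s (0\<^sub>v n) u = T i *\<^sub>v v" using Tcl v Wc unfolding s_def by auto
      then have "\<exists>w u'. T i *\<^sub>v v = s w u' \<and> w \<in> W \<and> (\<forall>j<d. u' j \<in> W)"
        using u W0 by (intro exI[of _ "0\<^sub>v n"] exI[of _ u]) simp
      then show ?thesis unfolding S_def by simp
    qed
    have subspS: "VectorSpace.subspace class_ring S V"
      using subS W unfolding VectorSpace.subspace_def by blast
    have "(2 - lam) * real (vectorspace.dim class_ring (vs W)) \<le> real (vectorspace.dim class_ring (vs S))"
    proof (rule word_mat_expansion[OF W[unfolded n_def] subspS[unfolded n_def] _ _ lam, folded n_def])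
      show "word_mat k w *\<^sub>v v \<in> S" if "w \<in> set (List.n_lists t gens)" "v \<in> W" for w v
        using that TW by (auto simp: in_set_conv_nth T_def d_def)
      have "(1 / 2 - lam) * real n \<le> 1 / 2 * real n" using lam by (intro mult_right_mono) auto
      with small have "real (vectorspace.dim class_ring (vs W)) \<le> 1 / 2 * real n" by linarith
      then show "real (vectorspace.dim class_ring (vs W)) \<le> 4 ^ k / 2" by (simp add: n_def)
    qed
    then show "(1 + (1 - lam)) * real (vectorspace.dim class_ring (vs W)) \<le>
      real (vectorspace.dim class_ring
        (vs {w + (\<Oplus>\<^bsub>V\<^esub>i\<in>{..<d}. T i *\<^sub>v u i) | w u. w \<in> W \<and> (\<forall>i<d. u i \<in> W)}))"
      by (simp add: S_def s_def)
  qed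
  then show ?thesis by (simp add: n_def d_def T_def)
qed

section \<open>Computing the matrices\<close>

definition exec :: "prog \<Rightarrow> stacks \<Rightarrow> nat \<Rightarrow> stacks \<Rightarrow> bool" where
  "exec P s B s' \<longleftrightarrow> (\<exists>t\<le>B. runs P s t s')"

text \<open>Bounds in place of exact counts let branches of different length share one cost; the
  equation \<open>s' = s''\<close> lets a computed final state be replaced by the intended one in
  the same step.\<close>

lemma exec_mono: "exec P s B s' \<Longrightarrow> B \<le> C \<Longrightarrow> s' = s'' \<Longrightarrow> exec P s C s''"
  unfolding exec_def by (auto intro: order_trans)

lemma exec_Skip: "exec Skip s 1 s"
  unfolding exec_def by (blast intro: runs_Skip order.refl)

lemma exec_Push: "exec (Push r a) s 1 (s(r := a # s r))"
  unfolding exec_def by (blast intro: runs_Push order.refl)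

lemma exec_Pop: "exec (Pop r) s 1 (s(r := tl (s r)))"
  unfolding exec_def by (blast intro: runs_Pop order.refl)

lemma exec_Seq: "exec P s B s' \<Longrightarrow> exec Q s' C s'' \<Longrightarrow> exec (Seq P Q) s (B + C) s''"
  unfolding exec_def by (meson add_mono runs_Seq)

lemma exec_Cond:
  assumes "b (top_sym (s r)) \<Longrightarrow> exec P s B s'" "\<not> b (top_sym (s r)) \<Longrightarrow> exec Q s B s'"
  shows "exec (Cond r b P Q) s (Suc B) s'"
proof (cases "b (top_sym (s r))")
  case True
  with assms(1) obtain t where "t \<le> B" "runs P s t s'" by (auto simp: exec_def)
  with True show ?thesis unfolding exec_def by (intro exI[of _ "1 + t"] conjI runs_CondT) simp_all
next
  case False
  with assms(2) obtain t where "t \<le> B" "runs Q s t s'" by (auto simp: exec_def)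
  with False show ?thesis unfolding exec_def by (intro exI[of _ "1 + t"] conjI runs_CondF) simp_all
qed

lemma exec_Loop_end: "\<not> b (top_sym (s r)) \<Longrightarrow> exec (Loop r b P) s 1 s"
  unfolding exec_def by (blast intro: runs_LoopF order.refl)

lemma exec_Loop_step:
  assumes "b (top_sym (s r))" "exec P s B s'" "exec (Loop r b P) s' C s''"
  shows "exec (Loop r b P) s (1 + B + C) s''"
proof -
  from assms(2,3) obtain t t' where "t \<le> B" "runs P s t s'" "t' \<le> C" "runs (Loop r b P) s' t' s''"
    by (auto simp: exec_def)
  with assms(1) show ?thesis
    unfolding exec_def by (intro exI[of _ "1 + t + t'"] conjI runs_LoopT) simp_all
qed

lemma top_sym_simps [simp]: "top_sym [] = None" "top_sym (c # l) = Some c"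
  by (simp_all add: top_sym_def)

definition nonempty :: "sym option \<Rightarrow> bool" where "nonempty x \<longleftrightarrow> x \<noteq> None"

lemma nonempty_simps [simp]: "\<not> nonempty None" "nonempty (Some c)"
  by (simp_all add: nonempty_def)

lemma nonempty_top [simp]: "nonempty (top_sym l) \<longleftrightarrow> l \<noteq> []"
  by (cases l) (auto simp: nonempty_def)

text \<open>Programs have no variables, so work depending on a symbol is written out once per
  symbol. An empty stack would reach the last branch; \<open>by_top\<close> is run only behind a
  test that the stack is nonempty.\<close>

definition by_top :: "nat \<Rightarrow> (sym \<Rightarrow> prog) \<Rightarrow> prog" where
  "by_top r f = Cond r (\<lambda>x. x = Some Zero) (f Zero) (Cond r (\<lambda>x. x = Some One) (f One)
     (Cond r (\<lambda>x. x = Some Minus) (f Minus) (f Sep)))"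

lemma exec_by_top:
  assumes "s r = c # l" "exec (f c) s B s'"
  shows "exec (by_top r f) s (B + 3) s'"
proof -
  have m: "exec (f c) s (Suc B) s'" "exec (f c) s (Suc (Suc B)) s'"
    using assms(2) by (auto intro: exec_mono)
  have "exec (by_top r f) s (Suc (Suc (Suc B))) s'"
    unfolding by_top_def
    by (intro exec_Cond) (use assms m in \<open>cases c; simp\<close>)+
  then show ?thesis by (simp add: eval_nat_numeral)
qed

section \<open>Elementary stack programs\<close>

definition move :: "(sym \<Rightarrow> sym) \<Rightarrow> nat \<Rightarrow> nat \<Rightarrow> prog" where
  "move f r q = Loop r nonempty (by_top r (\<lambda>c. Seq (Pop r) (Push q (f c))))"

lemma exec_move:
  "s r = l \<Longrightarrow> r \<noteq> q \<Longrightarrow>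
    exec (move f r q) s (6 * length l + 1) (s(r := [], q := rev (map f l) @ s q))"
proof (induction l arbitrary: s)
  case Nil
  then show ?case
    unfolding move_def by (intro exec_mono[OF exec_Loop_end]) (auto simp: fun_eq_iff)
next
  case (Cons c l)
  let ?s = "s(r := l, q := f c # s q)"
  have "exec (Seq (Pop r) (Push q (f c))) s (1 + 1) ?s"
    by (rule exec_mono[OF exec_Seq[OF exec_Pop exec_Push]]) (use Cons.prems in auto)
  then have 1: "exec (by_top r (\<lambda>c. Seq (Pop r) (Push q (f c)))) s (2 + 3) ?s"
    using Cons.prems by (intro exec_by_top) (auto simp: eval_nat_numeral)
  have 2: "exec (move f r q) ?s (6 * length l + 1) (?s(r := [], q := rev (map f l) @ ?s q))"
    using Cons.prems by (intro Cons.IH) auto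
  show ?case unfolding move_def
    by (rule exec_mono[OF exec_Loop_step[OF _ 1 2[unfolded move_def]]])
      (use Cons.prems in \<open>auto simp: fun_eq_iff\<close>)
qed

definition dup :: "nat \<Rightarrow> nat \<Rightarrow> nat \<Rightarrow> prog" where
  "dup r q q' = Loop r nonempty (by_top r (\<lambda>c. Seq (Pop r) (Seq (Push q c) (Push q' c))))"

lemma exec_dup:
  "s r = l \<Longrightarrow> r \<noteq> q \<Longrightarrow> r \<noteq> q' \<Longrightarrow> q \<noteq> q' \<Longrightarrow>
    exec (dup r q q') s (7 * length l + 1) (s(r := [], q := rev l @ s q, q' := rev l @ s q'))"
proof (induction l arbitrary: s)
  case Nil
  then show ?case
    unfolding dup_def by (intro exec_mono[OF exec_Loop_end]) (auto simp: fun_eq_iff)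
next
  case (Cons c l)
  let ?s = "s(r := l, q := c # s q, q' := c # s q')"
  have "exec (Seq (Pop r) (Seq (Push q c) (Push q' c))) s (1 + (1 + 1)) ?s"
    by (rule exec_mono[OF exec_Seq[OF exec_Pop exec_Seq[OF exec_Push exec_Push]]]) (use Cons.prems in auto)
  then have 1: "exec (by_top r (\<lambda>c. Seq (Pop r) (Seq (Push q c) (Push q' c)))) s (3 + 3) ?s"
    using Cons.prems by (intro exec_by_top) (auto simp: eval_nat_numeral)
  have 2: "exec (dup r q q') ?s (7 * length l + 1) (?s(r := [], q := rev l @ ?s q, q' := rev l @ ?s q'))"
    using Cons.prems by (intro Cons.IH) auto
  show ?case unfolding dup_def
    by (rule exec_mono[OF exec_Loop_step[OF _ 1 2[unfolded dup_def]]])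
      (use Cons.prems in \<open>auto simp: fun_eq_iff\<close>)
qed

definition copy :: "nat \<Rightarrow> nat \<Rightarrow> nat \<Rightarrow> prog" where
  "copy r q tmp = Seq (move (\<lambda>c. c) r tmp) (dup tmp r q)"

lemma exec_copy:
  assumes "s r = l" "s tmp = []" "s q = []" "r \<noteq> q" "r \<noteq> tmp" "q \<noteq> tmp"
  shows "exec (copy r q tmp) s (13 * length l + 2) (s(q := l))"
  unfolding copy_def
  by (rule exec_mono[OF exec_Seq[OF exec_move exec_dup[OF refl]]])
    (use assms in \<open>auto simp: fun_eq_iff\<close>)

definition bit_stack :: "bool \<Rightarrow> sym list" where "bit_stack b = (if b then [One] else [])"

lemma bit_stack_simps [simp]: "bit_stack True = [One]" "bit_stack False = []"
  "bit_stack b = [] \<longleftrightarrow> \<not> b"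
  by (simp_all add: bit_stack_def)

text \<open>Stack usage: 2 collects the output in reverse, 3 and 4 hold the row and column counters, 5 and 11
  the flags of the loops over rows and columns, 6 the word acted upon, 7 is temporary, 8 holds the
  sign, 9 a copy of the row counter, and 10 records a mismatch.\<close>

fun gen_prog :: "gen \<Rightarrow> prog" where
  "gen_prog GId = Skip"
| "gen_prog GRot = Seq (move rot 6 7) (move (\<lambda>c. c) 7 6)"
| "gen_prog GShear = Seq
     (Loop 6 nonempty (by_top 6 (\<lambda>c. Seq (Pop 6)
       (Cond 6 (\<lambda>x. x = Some One \<or> x = Some Sep) (Push 7 (yflip c)) (Push 7 c)))))
     (move (\<lambda>c. c) 7 6)"
| "gen_prog GZ = Cond 6 (\<lambda>x. x = Some One \<or> x = Some Sep) (Cond 8 nonempty (Pop 8) (Push 8 One)) Skip"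
| "gen_prog GX = Seq (move (\<lambda>c. c) 6 7)
     (Seq (Cond 7 nonempty (by_top 7 (\<lambda>c. Seq (Pop 7) (Push 7 (yflip c)))) Skip) (move (\<lambda>c. c) 7 6))"

lemma top_xbit: "(top_sym l = Some One \<or> top_sym l = Some Sep) \<longleftrightarrow> l \<noteq> [] \<and> xbit (hd l)"
  by (cases l) (auto simp: xbit_def)

lemma bump_snoc: "bump (l @ [c]) = l @ [yflip c]"
proof (induction l rule: bump.induct)
  case (2 d)
  then show ?case by simp
qed auto

text \<open>Once \<open>c\<close> is popped, the next block is on top and not yet altered, so its
  x-bit can be tested there. The result lies reversed on stack 7, which the \<open>move\<close> that
  follows in \<open>gen_prog\<close> undoes.\<close>

lemma exec_shear_loop:
  "s 6 = l \<Longrightarrow>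
    exec (Loop 6 nonempty (by_top 6 (\<lambda>c. Seq (Pop 6)
       (Cond 6 (\<lambda>x. x = Some One \<or> x = Some Sep) (Push 7 (yflip c)) (Push 7 c)))))
      s (7 * length l + 1) (s(6 := [], 7 := rev (shear l) @ s 7))"
proof (induction l arbitrary: s)
  case Nil
  then show ?case
    by (intro exec_mono[OF exec_Loop_end]) (auto simp: fun_eq_iff)
next
  case (Cons c l)
  let ?c = "if l \<noteq> [] \<and> xbit (hd l) then yflip c else c"
  let ?s = "s(6 := l, 7 := ?c # s 7)"
  have "exec (Cond 6 (\<lambda>x. x = Some One \<or> x = Some Sep) (Push 7 (yflip c)) (Push 7 c)) (s(6 := l)) (Suc 1) ?s"
    by (rule exec_Cond; rule exec_mono[OF exec_Push]) (auto simp: top_xbit)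
  then have "exec (Seq (Pop 6) (Cond 6 (\<lambda>x. x = Some One \<or> x = Some Sep) (Push 7 (yflip c)) (Push 7 c)))
      s (1 + Suc 1) ?s"
    using exec_Pop[of 6 s] Cons.prems by (intro exec_Seq) auto
  then have 1: "exec (by_top 6 (\<lambda>c. Seq (Pop 6)
       (Cond 6 (\<lambda>x. x = Some One \<or> x = Some Sep) (Push 7 (yflip c)) (Push 7 c)))) s (3 + 3) ?s"
    using Cons.prems by (intro exec_by_top) (auto simp: eval_nat_numeral)
  note 2 = Cons.IH[of ?s]
  show ?case
    by (rule exec_mono[OF exec_Loop_step[OF _ 1 2]])
      (use Cons.prems in \<open>auto simp: fun_eq_iff\<close>)
qed

lemma exec_gen_prog:
  assumes "s 6 = x" "s 7 = []" "s 8 = bit_stack p"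
  shows "exec (gen_prog g) s (20 * (length x + 1)) (s(6 := gen_perm g x, 8 := bit_stack (p \<noteq> gen_sign g x)))"
proof (cases g)
  case GId
  show ?thesis unfolding GId
    by (simp, rule exec_mono[OF exec_Skip]) (use assms in \<open>auto simp: fun_eq_iff\<close>)
next
  case GRot
  show ?thesis unfolding GRot gen_prog.simps
    by (rule exec_mono[OF exec_Seq[OF exec_move exec_move[OF refl]]])
      (use assms in \<open>auto simp: fun_eq_iff\<close>)
next
  case GShear
  show ?thesis unfolding GShear gen_prog.simps
    by (rule exec_mono[OF exec_Seq[OF exec_shear_loop exec_move[OF refl]]])
      (use assms in \<open>auto simp: fun_eq_iff\<close>)
next
  case GZ
  have toggle: "exec (Cond 8 nonempty (Pop 8) (Push 8 One)) s (Suc 1) (s(8 := bit_stack (\<not> p)))"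
    by (rule exec_Cond; rule exec_mono[OF exec_Pop] exec_mono[OF exec_Push])
      (use assms in \<open>auto simp: fun_eq_iff\<close>)
  have "exec (gen_prog GZ) s (Suc (Suc 1)) (s(6 := gen_perm g x, 8 := bit_stack (p \<noteq> gen_sign g x)))"
    unfolding gen_prog.simps
  proof (rule exec_Cond)
    assume "top_sym (s 6) = Some One \<or> top_sym (s 6) = Some Sep"
    then show "exec (Cond 8 nonempty (Pop 8) (Push 8 One)) s (Suc 1)
        (s(6 := gen_perm g x, 8 := bit_stack (p \<noteq> gen_sign g x)))"
      by (intro exec_mono[OF toggle]) (use assms GZ in \<open>auto simp: top_xbit fun_eq_iff\<close>)
  next
    assume "\<not> (top_sym (s 6) = Some One \<or> top_sym (s 6) = Some Sep)"
    then show "exec Skip s (Suc 1) (s(6 := gen_perm g x, 8 := bit_stack (p \<noteq> gen_sign g x)))"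
      by (intro exec_mono[OF exec_Skip]) (use assms GZ in \<open>auto simp: top_xbit fun_eq_iff\<close>)
  qed
  then show ?thesis unfolding GZ by (rule exec_mono) auto
next
  case GX
  let ?s = "s(6 := [], 7 := rev x)"
  let ?s' = "s(6 := [], 7 := rev (bump x))"
  have 1: "exec (move (\<lambda>c. c) 6 7) s (6 * length x + 1) ?s"
    by (rule exec_mono[OF exec_move]) (use assms in auto)
  have 2: "exec (Cond 7 nonempty (by_top 7 (\<lambda>c. Seq (Pop 7) (Push 7 (yflip c)))) Skip) ?s (Suc (1 + 1 + 3)) ?s'"
  proof (cases x rule: rev_cases)
    case Nil
    then show ?thesis by (intro exec_Cond) (auto intro!: exec_mono[OF exec_Skip])
  next
    case (snoc y c)
    have "exec (Seq (Pop 7) (Push 7 (yflip c))) ?s (1 + 1) ?s'"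
      by (rule exec_mono[OF exec_Seq[OF exec_Pop exec_Push]]) (auto simp: snoc bump_snoc fun_eq_iff)
    then have "exec (by_top 7 (\<lambda>c. Seq (Pop 7) (Push 7 (yflip c)))) ?s (1 + 1 + 3) ?s'"
      by (intro exec_by_top) (auto simp: snoc)
    then show ?thesis by (intro exec_Cond) (auto simp: snoc)
  qed
  have 3: "exec (move (\<lambda>c. c) 7 6) ?s' (6 * length x + 1) (s(6 := bump x))"
    by (rule exec_mono[OF exec_move[OF refl]]) (use assms in \<open>auto simp: fun_eq_iff\<close>)
  show ?thesis unfolding GX gen_prog.simps
    by (rule exec_mono[OF exec_Seq[OF 1 exec_Seq[OF 2 3]]])
      (use assms in \<open>auto simp: fun_eq_iff\<close>)
qed

fun word_prog :: "gen list \<Rightarrow> prog" where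
  "word_prog [] = Skip"
| "word_prog (g # w) = Seq (gen_prog g) (word_prog w)"

lemma exec_word_prog:
  "s 6 = x \<Longrightarrow> s 7 = [] \<Longrightarrow> s 8 = bit_stack p \<Longrightarrow>
    exec (word_prog w) s (20 * (length w + 1) * (length x + 1))
      (s(6 := word_perm w x, 8 := bit_stack (p \<noteq> word_sign w x)))"
proof (induction w arbitrary: s x p)
  case Nil
  show ?case
    by (simp, rule exec_mono[OF exec_Skip]) (use Nil in \<open>auto simp: fun_eq_iff\<close>)
next
  case (Cons g w)
  note 1 = exec_gen_prog[OF Cons.prems, of g]
  note 2 = Cons.IH[of "s(6 := gen_perm g x, 8 := bit_stack (p \<noteq> gen_sign g x))" "gen_perm g x" "p \<noteq> gen_sign g x"]
  have "(p = (\<not> (gen_sign g x = (\<not> word_sign w (gen_perm g x))))) = ((p = (\<not> gen_sign g x)) = (\<not> word_sign w (gen_perm g x)))" by auto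
  then show ?case unfolding word_prog.simps
    by (intro exec_mono[OF exec_Seq[OF 1 2]])
      (use Cons.prems in \<open>auto simp: fun_eq_iff algebra_simps\<close>)
qed

text \<open>The comparison does not stop at the first mismatch: both stacks must end empty for the
  next entry. The inner test keeps the flag at a single symbol.\<close>

definition compare_prog :: prog where
  "compare_prog = Loop 6 nonempty (by_top 6 (\<lambda>c. Seq
     (Cond 9 (\<lambda>x. x = Some c) Skip (Cond 10 nonempty Skip (Push 10 One))) (Seq (Pop 6) (Pop 9))))"

lemma exec_compare_prog:
  "length l = length m \<Longrightarrow> s 6 = l \<Longrightarrow> s 9 = m \<Longrightarrow> s 10 = bit_stack p \<Longrightarrow>
    exec compare_prog s (9 * length l + 1) (s(6 := [], 9 := [], 10 := bit_stack (p \<or> l \<noteq> m)))"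
proof (induction l m arbitrary: s p rule: list_induct2)
  case Nil
  then show ?case
    unfolding compare_prog_def by (intro exec_mono[OF exec_Loop_end]) (auto simp: fun_eq_iff)
next
  case (Cons c l d m)
  let ?p = "p \<or> c \<noteq> d"
  let ?s = "s(6 := l, 9 := m, 10 := bit_stack ?p)"
  have mark: "exec (Cond 10 nonempty Skip (Push 10 One)) s (Suc 1) (s(10 := bit_stack True))"
    by (rule exec_Cond; rule exec_mono[OF exec_Skip] exec_mono[OF exec_Push])
      (use Cons.prems in \<open>auto simp: fun_eq_iff\<close>)
  have "exec (Cond 9 (\<lambda>x. x = Some c) Skip (Cond 10 nonempty Skip (Push 10 One))) s (Suc (Suc 1))
      (s(10 := bit_stack ?p))"
  proof (rule exec_Cond)
    assume "top_sym (s 9) = Some c"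
    then show "exec Skip s (Suc 1) (s(10 := bit_stack ?p))"
      by (intro exec_mono[OF exec_Skip]) (use Cons.prems in \<open>auto simp: fun_eq_iff\<close>)
  next
    assume "top_sym (s 9) \<noteq> Some c"
    then show "exec (Cond 10 nonempty Skip (Push 10 One)) s (Suc 1) (s(10 := bit_stack ?p))"
      by (intro exec_mono[OF mark]) (use Cons.prems in auto)
  qed
  then have "exec (Seq (Cond 9 (\<lambda>x. x = Some c) Skip (Cond 10 nonempty Skip (Push 10 One))) (Seq (Pop 6) (Pop 9)))
      s (Suc (Suc 1) + (1 + 1)) ?s"
    by (intro exec_mono[OF exec_Seq[OF _ exec_Seq[OF exec_Pop exec_Pop]]])
      (use Cons.prems in \<open>auto simp: fun_eq_iff\<close>)
  then have 1: "exec (by_top 6 (\<lambda>c. Seq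
     (Cond 9 (\<lambda>x. x = Some c) Skip (Cond 10 nonempty Skip (Push 10 One))) (Seq (Pop 6) (Pop 9)))) s
      (Suc (Suc 1) + (1 + 1) + 3) ?s"
    using Cons.prems by (intro exec_by_top) auto
  note 2 = Cons.IH[of ?s ?p, unfolded compare_prog_def]
  show ?case unfolding compare_prog_def
    by (rule exec_mono[OF exec_Loop_step[OF _ 1 2]])
      (use Cons.prems in \<open>auto simp: fun_eq_iff\<close>)
qed

fun emit :: "sym list \<Rightarrow> prog" where
  "emit [] = Skip"
| "emit (c # l) = Seq (Push 2 c) (emit l)"

lemma exec_emit: "exec (emit l) s (length l + 1) (s(2 := rev l @ s 2))"
proof (induction l arbitrary: s)
  case Nil
  show ?case by (simp, rule exec_mono[OF exec_Skip]) auto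
next
  case (Cons c l)
  show ?case unfolding emit.simps
    by (rule exec_mono[OF exec_Seq[OF exec_Push Cons.IH]]) (auto simp: fun_eq_iff)
qed

text \<open>The polynomial \<open>X - e\<close>, given by its degree 1 and coefficients
  \<open>- e\<close> and 1, and then the disc about 0 of radius 2: u = v = 0, r = 2, q = 1. One disc
  serves all three values of \<open>e\<close>.\<close>

definition entry_ints :: "int \<Rightarrow> int list" where
  "entry_ints e = [1, - e, 1, 0, 0, 2, 1]"

definition entry_code :: "int \<Rightarrow> sym list" where
  "entry_code e = concat (map int_word (entry_ints e))"

definition emit_entry :: prog where
  "emit_entry = Cond 10 nonempty
     (Seq (emit (entry_code 0)) (Seq (Pop 10) (Pop 8)))
     (Cond 8 nonempty (Seq (emit (entry_code (-1))) (Pop 8)) (emit (entry_code 1)))"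

lemma exec_emit_entry:
  assumes "s 8 = bit_stack p" "s 10 = bit_stack q"
  shows "exec emit_entry s (length (entry_code 0) + length (entry_code 1) + length (entry_code (-1)) + 5)
    (s(8 := [], 10 := [], 2 := rev (entry_code (if q then 0 else if p then -1 else 1)) @ s 2))"
proof -
  let ?L = "length (entry_code 0) + length (entry_code 1) + length (entry_code (-1)) + 3"
  let ?s = "s(8 := [], 10 := [], 2 := rev (entry_code (if q then 0 else if p then -1 else 1)) @ s 2)"
  have 0: "exec (Seq (emit (entry_code 0)) (Seq (Pop 10) (Pop 8))) s (Suc ?L) ?s" if q
    by (rule exec_mono[OF exec_Seq[OF exec_emit exec_Seq[OF exec_Pop exec_Pop]]])
      (use assms that in \<open>auto simp: fun_eq_iff bit_stack_def\<close>)
  have 1: "exec (Seq (emit (entry_code (-1))) (Pop 8)) s ?L ?s" if "\<not> q" p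
    by (rule exec_mono[OF exec_Seq[OF exec_emit exec_Pop]])
      (use assms that in \<open>auto simp: fun_eq_iff\<close>)
  have 2: "exec (emit (entry_code 1)) s ?L ?s" if "\<not> q" "\<not> p"
    by (rule exec_mono[OF exec_emit]) (use assms that in \<open>auto simp: fun_eq_iff\<close>)
  have "exec emit_entry s (Suc (Suc ?L)) ?s"
    unfolding emit_entry_def
    by (intro exec_Cond) (use assms 0 1 2 in auto)
  then show ?thesis by (rule exec_mono) auto
qed

text \<open>No matrix is stored: the word acts on the column label, and the result is compared with
  the row label.\<close>

definition entry_prog :: "gen list \<Rightarrow> prog" where
  "entry_prog w = Seq (copy 4 6 7) (Seq (word_prog w) (Seq (copy 3 9 7) (Seq compare_prog emit_entry)))"

definition entry_cost :: "gen list \<Rightarrow> nat" where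
  "entry_cost w = 20 * (length w + 1) + 50 +
     (length (entry_code 0) + length (entry_code 1) + length (entry_code (-1)))"

definition scratch_clean :: "stacks \<Rightarrow> bool" where
  "scratch_clean s \<longleftrightarrow> s 6 = [] \<and> s 7 = [] \<and> s 8 = [] \<and> s 9 = [] \<and> s 10 = []"

lemma exec_entry_prog:
  assumes "s 3 = x" "s 4 = y" "length x = k" "length y = k" "scratch_clean s"
  shows "exec (entry_prog w) s (entry_cost w * (k + 1)) (s(2 := rev (entry_code (entry w x y)) @ s 2))"
proof -
  note clean = assms(5)[unfolded scratch_clean_def]
  let ?s1 = "s(6 := y)"
  let ?s2 = "s(6 := word_perm w y, 8 := bit_stack (word_sign w y))"
  let ?s3 = "s(6 := word_perm w y, 8 := bit_stack (word_sign w y), 9 := x)"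
  let ?s4 = "s(8 := bit_stack (word_sign w y), 10 := bit_stack (word_perm w y \<noteq> x))"
  let ?L = "length (entry_code 0) + length (entry_code 1) + length (entry_code (-1)) + 5"
  have 1: "exec (copy 4 6 7) s (13 * length y + 2) ?s1"
    by (rule exec_copy) (use assms clean in auto)
  have 2: "exec (word_prog w) ?s1 (20 * (length w + 1) * (length y + 1)) ?s2"
    by (rule exec_mono[OF exec_word_prog[where p = False]]) (use assms clean in \<open>auto simp: fun_eq_iff\<close>)
  have 3: "exec (copy 3 9 7) ?s2 (13 * length x + 2) ?s3"
    by (rule exec_copy) (use assms clean in auto)
  have 4: "exec compare_prog ?s3 (9 * length (word_perm w y) + 1) ?s4"
    by (rule exec_mono[OF exec_compare_prog[where p = False and m = x]]) (use assms clean in \<open>auto simp: fun_eq_iff\<close>)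
  have 5: "exec emit_entry ?s4 ?L (s(2 := rev (entry_code (entry w x y)) @ s 2))"
    by (rule exec_mono[OF exec_emit_entry]) (use assms clean in \<open>auto simp: fun_eq_iff entry_def\<close>)
  show ?thesis
    unfolding entry_prog_def
    by (rule exec_mono[OF exec_Seq[OF 1 exec_Seq[OF 2 exec_Seq[OF 3 exec_Seq[OF 4 5]]]] _ refl])
      (use assms in \<open>simp add: entry_cost_def algebra_simps\<close>)
qed


section \<open>A base 4 counter\<close>

fun succ_sym :: "sym \<Rightarrow> sym" where
  "succ_sym Zero = One" | "succ_sym One = Minus" | "succ_sym Minus = Sep" | "succ_sym Sep = Zero"

fun incr :: "sym list \<Rightarrow> sym list" where
  "incr [] = []"
| "incr (c # l) = (if c = Sep then Zero # incr l else succ_sym c # l)"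

definition overflows :: "sym list \<Rightarrow> bool" where "overflows l \<longleftrightarrow> (\<forall>c\<in>set l. c = Sep)"

lemma overflows_simps [simp]: "overflows []" "overflows (c # l) \<longleftrightarrow> c = Sep \<and> overflows l"
  by (auto simp: overflows_def)

lemma incr_overflows: "overflows l \<Longrightarrow> incr l = replicate (length l) Zero"
  by (induction l) auto

text \<open>Running out of digits during the carry means overflow; then the flag \<open>f\<close> is
  popped, which ends the surrounding loop. The counter is back at zero by then, ready for the next
  run.\<close>

definition incr_prog :: "nat \<Rightarrow> nat \<Rightarrow> prog" where
  "incr_prog r f = Seq (Loop r (\<lambda>x. x = Some Sep) (Seq (Pop r) (Push 7 Zero)))
     (Seq (Cond r nonempty (by_top r (\<lambda>c. Seq (Pop r) (Push r (succ_sym c)))) (Pop f))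
       (move (\<lambda>c. c) 7 r))"

lemma exec_carry_loop:
  "s r = l \<Longrightarrow> r \<noteq> 7 \<Longrightarrow>
    exec (Loop r (\<lambda>x. x = Some Sep) (Seq (Pop r) (Push 7 Zero))) s (3 * length l + 1)
      (s(r := dropWhile (\<lambda>c. c = Sep) l, 7 := replicate (length (takeWhile (\<lambda>c. c = Sep) l)) Zero @ s 7))"
proof (induction l arbitrary: s)
  case Nil
  then show ?case by (intro exec_mono[OF exec_Loop_end]) (auto simp: fun_eq_iff)
next
  case (Cons c l)
  show ?case
  proof (cases "c = Sep")
    case True
    let ?s = "s(r := l, 7 := Zero # s 7)"
    have 1: "exec (Seq (Pop r) (Push 7 Zero)) s (1 + 1) ?s"
      by (rule exec_mono[OF exec_Seq[OF exec_Pop exec_Push]]) (use Cons.prems in auto)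
    note 2 = Cons.IH[of ?s]
    show ?thesis
      by (rule exec_mono[OF exec_Loop_step[OF _ 1 2]])
        (use Cons.prems True in \<open>auto simp: fun_eq_iff replicate_app_Cons_same\<close>)
  next
    case False
    with Cons.prems show ?thesis
      by (intro exec_mono[OF exec_Loop_end]) (auto simp: fun_eq_iff)
  qed
qed

lemma incr_eq:
  "incr l = replicate (length (takeWhile (\<lambda>c. c = Sep) l)) Zero @
    (case dropWhile (\<lambda>c. c = Sep) l of [] \<Rightarrow> [] | c # m \<Rightarrow> succ_sym c # m)"
  by (induction l) auto

lemma overflows_eq: "overflows l \<longleftrightarrow> dropWhile (\<lambda>c. c = Sep) l = []"
  by (simp add: overflows_def)

lemma exec_incr_prog:
  assumes "s r = l" "s 7 = []" "r \<noteq> 7" "f \<noteq> 7" "f \<noteq> r"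
  shows "exec (incr_prog r f) s (9 * length l + 10)
    (s(r := incr l, f := if overflows l then tl (s f) else s f))"
proof -
  define a where "a = replicate (length (takeWhile (\<lambda>c. c = Sep) l)) Zero"
  define m where "m = dropWhile (\<lambda>c. c = Sep) l"
  define m' where "m' = (case m of [] \<Rightarrow> [] | c # m \<Rightarrow> succ_sym c # m)"
  let ?s1 = "s(r := m, 7 := a)"
  let ?s2 = "s(r := m', 7 := a, f := if overflows l then tl (s f) else s f)"
  have len: "length a \<le> length l" unfolding a_def by (simp add: length_takeWhile_le)
  have 1: "exec (Loop r (\<lambda>x. x = Some Sep) (Seq (Pop r) (Push 7 Zero))) s (3 * length l + 1) ?s1"
    by (rule exec_mono[OF exec_carry_loop]) (use assms in \<open>auto simp: a_def m_def\<close>)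
  have 2: "exec (Cond r nonempty (by_top r (\<lambda>c. Seq (Pop r) (Push r (succ_sym c)))) (Pop f)) ?s1
      (Suc (1 + 1 + 3)) ?s2"
  proof (cases m)
    case Nil
    then have "overflows l" by (simp add: overflows_eq m_def)
    with Nil show ?thesis
      by (intro exec_Cond) (use assms in \<open>auto simp: m'_def fun_eq_iff intro!: exec_mono[OF exec_Pop]\<close>)
  next
    case (Cons c n)
    then have "\<not> overflows l" by (auto simp: overflows_eq m_def)
    with Cons have "exec (Seq (Pop r) (Push r (succ_sym c))) ?s1 (1 + 1) ?s2"
      by (intro exec_mono[OF exec_Seq[OF exec_Pop exec_Push]]) (use assms in \<open>auto simp: m'_def fun_eq_iff\<close>)
    then have "exec (by_top r (\<lambda>c. Seq (Pop r) (Push r (succ_sym c)))) ?s1 (1 + 1 + 3) ?s2"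
      by (intro exec_by_top) (use assms Cons in auto)
    then show ?thesis by (intro exec_Cond) (use assms Cons in auto)
  qed
  have 3: "exec (move (\<lambda>c. c) 7 r) ?s2 (6 * length l + 1) (s(r := incr l, f := if overflows l then tl (s f) else s f))"
    by (rule exec_mono[OF exec_move[OF refl]])
      (use assms len in \<open>auto simp: fun_eq_iff incr_eq[of l] m'_def m_def a_def\<close>)
  show ?thesis unfolding incr_prog_def
    by (rule exec_mono[OF exec_Seq[OF 1 exec_Seq[OF 2 3]]]) auto
qed

fun counts_up :: "sym list list \<Rightarrow> bool" where
  "counts_up [] \<longleftrightarrow> False"
| "counts_up [w] \<longleftrightarrow> overflows w"
| "counts_up (w # w' # ws) \<longleftrightarrow> \<not> overflows w \<and> incr w = w' \<and> counts_up (w' # ws)"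

text \<open>A new least significant digit splits each step into four; from \<open>Sep\<close> the
  carry performs the old step and resets the digit.\<close>

lemma counts_up_digits:
  "counts_up ws \<Longrightarrow> counts_up (concat (map (\<lambda>w. map (\<lambda>c. c # w) [Zero, One, Minus, Sep]) ws))"
  by (induction ws rule: counts_up.induct) auto

lemma counts_up_word_list: "counts_up (word_list k)"
proof (induction k)
  case (Suc k)
  from counts_up_digits[OF this] show ?case by simp
qed simp

lemma hd_word_list: "hd (word_list k) = replicate k Zero"
proof (induction k)
  case (Suc k)
  have "word_list k \<noteq> []" using length_word_list[of k] by auto
  then show ?case using Suc by (cases "word_list k") auto
qed simp

text \<open>The body runs before the first increment, so the zero word is included. For
  \<open>k = 0\<close> the empty word overflows at once, after a single pass.\<close>

definition for_words :: "nat \<Rightarrow> nat \<Rightarrow> prog \<Rightarrow> prog" where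
  "for_words r f body = Seq (Push f One) (Loop f nonempty (Seq body (incr_prog r f)))"

text \<open>The invariant \<open>I\<close> is abstract so that the loop can be nested: the inner
  loop fixes the row counter, the outer one keeps the column counter at zero and the inner flag
  cleared. The net effect of a body is confined to the output.\<close>

lemma exec_for_words_loop:
  assumes body: "\<And>s x. I s \<Longrightarrow> s r = x \<Longrightarrow> length x = k \<Longrightarrow> exec body s B (s(2 := rev (out x) @ s 2))"
    and I7: "\<And>s. I s \<Longrightarrow> s 7 = []"
    and I2: "\<And>s v. I s \<Longrightarrow> I (s(2 := v))" and Ir: "\<And>s v. I s \<Longrightarrow> I (s(r := v))"
    and If: "\<And>s v. I s \<Longrightarrow> I (s(f := v))"
    and regs: "r \<noteq> 7" "f \<noteq> 7" "f \<noteq> r" "r \<noteq> 2" "f \<noteq> 2"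
  shows "counts_up ws \<Longrightarrow> \<forall>w\<in>set ws. length w = k \<Longrightarrow> I s \<Longrightarrow> s r = hd ws \<Longrightarrow> s f = [One] \<Longrightarrow>
    exec (Loop f nonempty (Seq body (incr_prog r f))) s (length ws * (B + 9 * k + 11) + 1)
      (s(r := replicate k Zero, f := [], 2 := rev (concat (map out ws)) @ s 2))"
proof (induction ws arbitrary: s rule: counts_up.induct)
  case 1
  then show ?case by simp
next
  case (2 w)
  let ?s = "s(r := replicate k Zero, f := [], 2 := rev (out w) @ s 2)"
  have b: "exec body s B (s(2 := rev (out w) @ s 2))"
    using 2 by (intro body) auto
  have "exec (incr_prog r f) (s(2 := rev (out w) @ s 2)) (9 * length w + 10) ?s"
    by (rule exec_mono[OF exec_incr_prog[where l = w]])
      (use 2 regs I7[of s] in \<open>auto simp: fun_eq_iff incr_overflows\<close>)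
  note 1 = exec_Seq[OF b this]
  show ?case
    by (rule exec_mono[OF exec_Loop_step[OF _ 1 exec_Loop_end]])
      (use 2 regs in \<open>auto simp: fun_eq_iff\<close>)
next
  case (3 w w' ws)
  let ?s = "s(r := w', 2 := rev (out w) @ s 2)"
  have b: "exec body s B (s(2 := rev (out w) @ s 2))"
    using 3 by (intro body) auto
  have "exec (incr_prog r f) (s(2 := rev (out w) @ s 2)) (9 * length w + 10) ?s"
    by (rule exec_mono[OF exec_incr_prog[where l = w]])
      (use 3 regs I7[of s] in \<open>auto simp: fun_eq_iff\<close>)
  note 1 = exec_Seq[OF b this]
  have 2: "exec (Loop f nonempty (Seq body (incr_prog r f))) ?s (length (w' # ws) * (B + 9 * k + 11) + 1)
      (?s(r := replicate k Zero, f := [], 2 := rev (concat (map out (w' # ws))) @ ?s 2))"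
  proof (rule 3(1))
    show "I ?s" using 3 by (intro I2 Ir) simp
  qed (use 3 regs in auto)
  show ?case
    by (rule exec_mono[OF exec_Loop_step[OF _ 1 2]])
      (use 3 regs in \<open>auto simp: fun_eq_iff\<close>)
qed

lemma exec_for_words:
  assumes "\<And>s x. I s \<Longrightarrow> s r = x \<Longrightarrow> length x = k \<Longrightarrow> exec body s B (s(2 := rev (out x) @ s 2))"
    and "\<And>s. I s \<Longrightarrow> s 7 = []"
    and "\<And>s v. I s \<Longrightarrow> I (s(2 := v))" and "\<And>s v. I s \<Longrightarrow> I (s(r := v))"
    and If: "\<And>s v. I s \<Longrightarrow> I (s(f := v))"
    and regs: "r \<noteq> 7" "f \<noteq> 7" "f \<noteq> r" "r \<noteq> 2" "f \<noteq> 2"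
    and s: "I s" "s r = replicate k Zero" "s f = []"
  shows "exec (for_words r f body) s (4 ^ k * (B + 9 * k + 11) + 2)
      (s(2 := rev (concat (map out (word_list k))) @ s 2))"
proof -
  let ?s = "s(f := [One])"
  have 1: "exec (Push f One) s 1 ?s"
    by (rule exec_mono[OF exec_Push]) (use s in auto)
  have 2: "exec (Loop f nonempty (Seq body (incr_prog r f))) ?s (length (word_list k) * (B + 9 * k + 11) + 1)
      (?s(r := replicate k Zero, f := [], 2 := rev (concat (map out (word_list k))) @ ?s 2))"
    by (rule exec_for_words_loop[of I]) (use assms set_word_list[of k] hd_word_list[of k]
      counts_up_word_list[of k] in \<open>auto simp: words_def\<close>)
  show ?thesis unfolding for_words_def
    by (rule exec_mono[OF exec_Seq[OF 1 2]]) (use s regs in \<open>auto simp: fun_eq_iff length_word_list\<close>)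
qed

section \<open>Printing the matrices\<close>

definition matrix_prog :: "gen list \<Rightarrow> prog" where
  "matrix_prog w = for_words 3 5 (for_words 4 11 (entry_prog w))"

definition matrix_word :: "nat \<Rightarrow> gen list \<Rightarrow> sym list" where
  "matrix_word k w =
    concat (map (\<lambda>x. concat (map (\<lambda>y. entry_code (entry w x y)) (word_list k))) (word_list k))"

definition ready :: "nat \<Rightarrow> stacks \<Rightarrow> bool" where
  "ready k s \<longleftrightarrow> scratch_clean s \<and> s 3 = replicate k Zero \<and> s 4 = replicate k Zero \<and> s 5 = [] \<and> s 11 = []"

text \<open>There are \<open>n * n\<close> entries for \<open>n = 4 ^ k\<close>, each at a cost of
  order at most \<open>k + 1 \<le> n\<close>, which gives the cube.\<close>

lemma exec_matrix_prog:
  assumes "ready k s"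
  shows "exec (matrix_prog w) s ((entry_cost w + 100) * (4 ^ k) ^ 3) (s(2 := rev (matrix_word k w) @ s 2))"
proof -
  define n :: nat where "n = 4 ^ k"
  have kn: "k + 1 \<le> n" unfolding n_def by (induction k) auto
  have inner: "exec (for_words 4 11 (entry_prog w)) s (4 ^ k * (entry_cost w * (k + 1) + 9 * k + 11) + 2)
      (s(2 := rev (concat (map (\<lambda>y. entry_code (entry w x y)) (word_list k))) @ s 2))"
    if "scratch_clean s \<and> s 4 = replicate k Zero \<and> s 11 = []" "s 3 = x" "length x = k" for s x
  proof (rule exec_for_words[where I = "\<lambda>s. scratch_clean s \<and> s 3 = x"])
    show "exec (entry_prog w) s (entry_cost w * (k + 1)) (s(2 := rev (entry_code (entry w x y)) @ s 2))"
      if "scratch_clean s \<and> s 3 = x" "s 4 = y" "length y = k" for s y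
      using that \<open>length x = k\<close> by (intro exec_entry_prog) auto
  qed (use that in \<open>auto simp: scratch_clean_def\<close>)
  have "exec (matrix_prog w) s
      (4 ^ k * ((4 ^ k * (entry_cost w * (k + 1) + 9 * k + 11) + 2) + 9 * k + 11) + 2)
      (s(2 := rev (matrix_word k w) @ s 2))"
    unfolding matrix_prog_def matrix_word_def
  proof (rule exec_for_words[where I = "\<lambda>s. scratch_clean s \<and> s 4 = replicate k Zero \<and> s 11 = []"])
    show "exec (for_words 4 11 (entry_prog w)) s (4 ^ k * (entry_cost w * (k + 1) + 9 * k + 11) + 2)
        (s(2 := rev (concat (map (\<lambda>y. entry_code (entry w x y)) (word_list k))) @ s 2))"
      if "scratch_clean s \<and> s 4 = replicate k Zero \<and> s 11 = []" "s 3 = x" "length x = k" for s x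
      using that by (rule inner)
  qed (use assms in \<open>auto simp: ready_def scratch_clean_def\<close>)
  moreover have "4 ^ k * ((4 ^ k * (entry_cost w * (k + 1) + 9 * k + 11) + 2) + 9 * k + 11) + 2
      \<le> (entry_cost w + 100) * (4 ^ k) ^ 3"
  proof -
    have "entry_cost w * (k + 1) + 9 * k + 11 \<le> (entry_cost w + 20) * n"
      using mult_left_mono[OF kn, of "entry_cost w"] kn by (simp add: algebra_simps)
    then have "n * (entry_cost w * (k + 1) + 9 * k + 11) \<le> (entry_cost w + 20) * (n * n)"
      using mult_left_mono[of _ _ n] by (simp add: mult_ac)
    moreover have nn: "n \<le> n * n" "1 \<le> n * n" using kn by (cases n; simp)+
    moreover have "2 + 9 * k + 11 \<le> 13 * (n * n)" using kn nn by linarith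
    ultimately have "n * (entry_cost w * (k + 1) + 9 * k + 11) + 2 + 9 * k + 11 \<le>
        (entry_cost w + 20) * (n * n) + 13 * (n * n)" by linarith
    also have "\<dots> \<le> (entry_cost w + 60) * (n * n)" by (simp add: add_mult_distrib)
    finally have "n * (entry_cost w * (k + 1) + 9 * k + 11) + 2 + 9 * k + 11 \<le> (entry_cost w + 60) * (n * n)" .
    then have "n * (n * (entry_cost w * (k + 1) + 9 * k + 11) + 2 + 9 * k + 11) \<le> (entry_cost w + 60) * (n * n * n)"
      using mult_left_mono[of _ _ n] by (simp add: mult_ac)
    moreover have "1 \<le> n * n * n" using kn by (cases n) auto
    ultimately have "n * (n * (entry_cost w * (k + 1) + 9 * k + 11) + 2 + 9 * k + 11) + 2 \<le>
        (entry_cost w + 60) * (n * n * n) + 2 * (n * n * n)" by linarith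
    also have "\<dots> \<le> (entry_cost w + 100) * (n * n * n)" by (simp add: add_mult_distrib)
    finally show ?thesis unfolding n_def[symmetric] by (simp add: power3_eq_cube mult.assoc)
  qed
  ultimately show ?thesis by (rule exec_mono) simp
qed


fun matrices_prog :: "gen list list \<Rightarrow> prog" where
  "matrices_prog [] = Skip"
| "matrices_prog (w # ws) = Seq (matrix_prog w) (matrices_prog ws)"

definition matrices_cost :: "gen list list \<Rightarrow> nat" where
  "matrices_cost ws = (\<Sum>w\<leftarrow>ws. entry_cost w + 100) + 1"

lemma exec_matrices_prog:
  "ready k s \<Longrightarrow> exec (matrices_prog ws) s (matrices_cost ws * (4 ^ k) ^ 3)
    (s(2 := rev (concat (map (matrix_word k) ws)) @ s 2))"
proof (induction ws arbitrary: s)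
  case Nil
  show ?case by (simp, rule exec_mono[OF exec_Skip]) (auto simp: matrices_cost_def)
next
  case (Cons w ws)
  let ?s = "s(2 := rev (matrix_word k w) @ s 2)"
  have "ready k ?s" using Cons.prems by (simp add: ready_def scratch_clean_def)
  note 2 = Cons.IH[OF this]
  show ?case unfolding matrices_prog.simps
    by (rule exec_mono[OF exec_Seq[OF exec_matrix_prog[OF Cons.prems] 2]])
      (auto simp: fun_eq_iff matrices_cost_def algebra_simps)
qed

text \<open>The binary digits of \<open>4 ^ k\<close>, least significant first, are
  \<open>2 * k\<close> zeros and a one. Each unit of the unary input therefore puts two zeros on the
  output and one on each counter.\<close>

definition init_prog :: prog where
  "init_prog = Loop 0 nonempty (Seq (Pop 0) (Seq (Push 2 Zero) (Seq (Push 2 Zero) (Seq (Push 3 Zero) (Push 4 Zero)))))"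

lemma exec_init_prog:
  "s 0 = replicate k One \<Longrightarrow> exec init_prog s (6 * k + 1)
    (s(0 := [], 2 := replicate (2 * k) Zero @ s 2, 3 := replicate k Zero @ s 3, 4 := replicate k Zero @ s 4))"
proof (induction k arbitrary: s)
  case 0
  then show ?case unfolding init_prog_def
    by (intro exec_mono[OF exec_Loop_end]) (auto simp: fun_eq_iff)
next
  case (Suc k)
  let ?s = "s(0 := replicate k One, 2 := Zero # Zero # s 2, 3 := Zero # s 3, 4 := Zero # s 4)"
  have 1: "exec (Seq (Pop 0) (Seq (Push 2 Zero) (Seq (Push 2 Zero) (Seq (Push 3 Zero) (Push 4 Zero))))) s
      (1 + (1 + (1 + (1 + 1)))) ?s"
    by (rule exec_mono[OF exec_Seq[OF exec_Pop exec_Seq[OF exec_Push exec_Seq[OF exec_Push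
      exec_Seq[OF exec_Push exec_Push]]]]])
      (use Suc.prems in \<open>auto simp: fun_eq_iff\<close>)
  note 2 = Suc.IH[of ?s, unfolded init_prog_def]
  show ?case unfolding init_prog_def
    by (rule exec_mono[OF exec_Loop_step[OF _ 1 2]])
      (use Suc.prems in \<open>auto simp: fun_eq_iff replicate_app_Cons_same\<close>)
qed

text \<open>A step pushes at most one symbol, so the length of the output is bounded by the time spent on it.\<close>

lemma runs_length_le: "runs P s t s' \<Longrightarrow> length (s' r) \<le> length (s r) + t"
proof (induction rule: runs.induct)
  case (runs_Pop r' s)
  have "length (tl (s r')) \<le> length (s r')" by simp
  then show ?case by auto
qed auto

text \<open>The emitted \<open>One\<close> and \<open>Sep\<close> finish the code of the dimension
  begun by \<open>init_prog\<close>. The last move reverses the collected output onto stack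
  1.\<close>

definition family_prog :: "gen list list \<Rightarrow> prog" where
  "family_prog ws = Seq init_prog (Seq (emit ([One, Sep] @ int_word (int (length ws))))
     (Seq (matrices_prog ws) (move (\<lambda>c. c) 2 1)))"

definition family_word :: "nat \<Rightarrow> gen list list \<Rightarrow> sym list" where
  "family_word k ws = replicate (2 * k) Zero @ [One, Sep] @ int_word (int (length ws)) @
     concat (map (matrix_word k) ws)"

lemma family_prog_computes:
  "\<exists>C. \<forall>k. \<exists>t \<le> C * (4 ^ k) ^ 3. computes_in (family_prog ws) k (family_word k ws) t"
proof -
  define L where "L = length ([One, Sep] @ int_word (int (length ws)))"
  have "\<exists>t \<le> 7 * (7 + L + 1 + matrices_cost ws + 1) * (4 ^ k) ^ 3.
      computes_in (family_prog ws) k (family_word k ws) t" for k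
  proof -
    define N :: nat where "N = (4 ^ k) ^ 3"
    have kN: "k + 1 \<le> N" "1 \<le> N"
    proof -
      have "k + 1 \<le> 4 ^ k" by (induction k) auto
      also have "(4 :: nat) ^ k \<le> (4 ^ k) ^ 3" by (rule self_le_power) auto
      finally show "k + 1 \<le> N" by (simp add: N_def)
      then show "1 \<le> N" by simp
    qed
    let ?h = "[One, Sep] @ int_word (int (length ws))"
    let ?s0 = "unary_input k"
    let ?s1 = "?s0(0 := [], 2 := replicate (2 * k) Zero, 3 := replicate k Zero, 4 := replicate k Zero)"
    let ?s2 = "?s1(2 := rev ?h @ replicate (2 * k) Zero)"
    let ?s3 = "?s1(2 := rev (family_word k ws))"
    define B where "B = (6 * k + 1) + ((L + 1) + matrices_cost ws * N)"
    have 1: "exec init_prog ?s0 (6 * k + 1) ?s1"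
      by (rule exec_mono[OF exec_init_prog[where k = k]]) (auto simp: unary_input_def fun_eq_iff)
    have 2: "exec (emit ?h) ?s1 (L + 1) ?s2"
      unfolding L_def by (rule exec_mono[OF exec_emit]) (auto simp: fun_eq_iff)
    have "ready k ?s2" by (simp add: ready_def scratch_clean_def unary_input_def)
    then have 3: "exec (matrices_prog ws) ?s2 (matrices_cost ws * N) ?s3"
      unfolding N_def by (rule exec_mono[OF exec_matrices_prog]) (auto simp: fun_eq_iff family_word_def)
    \<comment> \<open>The part before the final move is run on its own: its time bound
      \<open>B\<close> also bounds the length of the output and therefore the cost of the
      move.\<close>
    have "exec (Seq init_prog (Seq (emit ?h) (matrices_prog ws))) ?s0 B ?s3"
      unfolding B_def by (rule exec_Seq[OF 1 exec_Seq[OF 2 3]])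
    then obtain u where u: "u \<le> B"
      "runs (Seq init_prog (Seq (emit ?h) (matrices_prog ws))) ?s0 u ?s3" by (auto simp only: exec_def)
    from runs_length_le[OF u(2), of 2] u(1) have "length (?s3 2) \<le> length (?s0 2) + B" by linarith
    then have len: "length (family_word k ws) \<le> B" by (simp add: unary_input_def)
    have 4: "exec (move (\<lambda>c. c) 2 1) ?s3 (6 * B + 1) (?s3(2 := [], 1 := family_word k ws))"
      by (rule exec_mono[OF exec_move[OF refl]]) (use len in \<open>auto simp: fun_eq_iff unary_input_def\<close>)
    have "exec (family_prog ws) ?s0 ((6 * k + 1) + ((L + 1) + (matrices_cost ws * N + (6 * B + 1))))
        (?s3(2 := [], 1 := family_word k ws))"
      unfolding family_prog_def by (rule exec_Seq[OF 1 exec_Seq[OF 2 exec_Seq[OF 3 4]]])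
    then obtain t where t: "t \<le> (6 * k + 1) + ((L + 1) + (matrices_cost ws * N + (6 * B + 1)))"
      "runs (family_prog ws) ?s0 t (?s3(2 := [], 1 := family_word k ws))"
      by (auto simp: exec_def)
    have "B \<le> (7 + L + 1 + matrices_cost ws) * N"
    proof -
      have "6 * k + 1 \<le> 7 * N" using kN by linarith
      moreover have "(L + 1) * 1 \<le> (L + 1) * N" using kN(2) by (rule mult_left_mono) simp
      ultimately show ?thesis by (simp add: B_def algebra_simps)
    qed
    moreover have "t \<le> 7 * B + 1" using t(1) by (simp add: B_def algebra_simps)
    ultimately have "t \<le> 7 * (7 + L + 1 + matrices_cost ws + 1) * N"
      using kN(2) by (simp add: algebra_simps)
    moreover have "computes_in (family_prog ws) k (family_word k ws) t"
      unfolding computes_in_def using t(2) by (intro exI conjI) (assumption, simp)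
    ultimately show ?thesis by (auto simp: N_def)
  qed
  then show ?thesis by blast
qed

section \<open>The output is a code of the matrices\<close>

lemma algebraic_code_entry:
  assumes "e \<in> {-1, 0, 1}"
  shows "algebraic_code (entry_ints e) (of_int e)"
  unfolding algebraic_code_def
proof (intro exI conjI)
  show "entry_ints e = int (degree [: -e, 1 :]) # coeffs [: -e, 1 :] @ [0, 0, 2, 1]"
    by (simp add: entry_ints_def)
  show "{y. poly (map_poly of_int [: -e, 1 :]) y = 0 \<and>
      cmod (y - Complex (real_of_int 0 / real_of_int 1) (real_of_int 0 / real_of_int 1))
        < real_of_int 2 / real_of_int 1} = {of_int e}"
    using assms by (auto simp: map_poly_pCons complex_eq_iff[of "Complex 0 0" 0, simplified])
qed simp_all

lemma nat_word_power: "nat_word (4 ^ k) = replicate (2 * k) Zero @ [One]"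
proof (induction k)
  case 0
  have "nat_word (Suc 0) = [One]" by simp
  then show ?case by simp
next
  case (Suc k)
  have step: "nat_word (2 * m) = Zero # nat_word m" if "m > 0" for m
  proof -
    from that have m: "Suc (2 * m - 1) = 2 * m" by simp
    show ?thesis using nat_word.simps(2)[of "2 * m - 1"] unfolding m by simp
  qed
  have "nat_word (4 ^ Suc k) = nat_word (2 * (2 * 4 ^ k))" by simp
  also have "\<dots> = Zero # Zero # nat_word (4 ^ k)"
    using step[of "2 * 4 ^ k"] step[of "4 ^ k"] by (simp only:) simp
  finally show ?case using Suc by simp
qed

lemma concat_map_concat: "concat (map f (concat xss)) = concat (map (\<lambda>xs. concat (map f xs)) xss)"
  by (induction xss) auto

lemma map_nth_upt: "length l = n \<Longrightarrow> map (\<lambda>i. f (l ! i)) [0..<n] = map f l"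
  by (rule nth_equalityI) auto

lemma explicit_family_word_mat:
  "explicit_family (\<lambda>k. 4 ^ k) (\<lambda>_. length ws) (\<lambda>k i. word_mat k (ws ! i))"
proof -
  obtain C where C: "\<And>k. \<exists>t \<le> C * (4 ^ k) ^ 3. computes_in (family_prog ws) k (family_word k ws) t"
    using family_prog_computes[of ws] by blast
  have code: "matrices_code (4 ^ k) (length ws) (\<lambda>i. word_mat k (ws ! i)) (family_word k ws)" for k
    unfolding matrices_code_def
  proof (intro exI conjI allI impI)
    let ?e = "\<lambda>i a b. entry_ints (entry (ws ! i) (word_list k ! a) (word_list k ! b))"
    show "algebraic_code (?e i a b) (word_mat k (ws ! i) $$ (a, b))"
      if "i < length ws" "a < 4 ^ k" "b < 4 ^ k" for i a b
      using that algebraic_code_entry[of "entry (ws ! i) (word_list k ! a) (word_list k ! b)"]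
      by (auto simp: word_mat_def entry_def)
    have 1: "map (\<lambda>b. entry_ints (entry w x (word_list k ! b))) [0..<4 ^ k] =
        map (\<lambda>y. entry_ints (entry w x y)) (word_list k)" for w x
      by (rule map_nth_upt[OF length_word_list])
    have 2: "map (\<lambda>a. map (\<lambda>y. entry_ints (entry w (word_list k ! a) y)) (word_list k)) [0..<4 ^ k] =
        map (\<lambda>x. map (\<lambda>y. entry_ints (entry w x y)) (word_list k)) (word_list k)" for w
      by (rule map_nth_upt[OF length_word_list])
    have 3: "map (\<lambda>i. concat (map (\<lambda>x. map (\<lambda>y. entry_ints (entry (ws ! i) x y)) (word_list k)) (word_list k)))
          [0..<length ws] =
        map (\<lambda>w. concat (map (\<lambda>x. map (\<lambda>y. entry_ints (entry w x y)) (word_list k)) (word_list k))) ws"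
      by (rule map_nth_upt[OF refl])
    have "concat [?e i a b. i \<leftarrow> [0..<length ws], a \<leftarrow> [0..<4 ^ k], b \<leftarrow> [0..<4 ^ k]] =
        concat (concat (map (\<lambda>w. concat (map (\<lambda>x. map (\<lambda>y. entry_ints (entry w x y)) (word_list k)) (word_list k))) ws))"
      by (simp only: 1 2 3)
    moreover have "concat (map int_word (concat (concat (map (\<lambda>w. concat (map (\<lambda>x. map (\<lambda>y. entry_ints (entry w x y)) (word_list k)) (word_list k))) ws))))
        = concat (map (matrix_word k) ws)"
      by (simp add: concat_map_concat comp_def matrix_word_def[abs_def] entry_code_def)
    moreover have "int_word (int (4 ^ k)) = replicate (2 * k) Zero @ [One, Sep]"
      by (simp add: int_word_def nat_word_power nat_power_eq)
    ultimately show "family_word k ws = concat (map int_word ([int (4 ^ k), int (length ws)] @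
        concat [?e i a b. i \<leftarrow> [0..<length ws], a \<leftarrow> [0..<4 ^ k], b \<leftarrow> [0..<4 ^ k]]))"
      by (simp add: family_word_def)
  qed
  show ?thesis
    unfolding explicit_family_def
  \<comment> \<open>\<open>C\<close> depends on \<open>ws\<close> but not on \<open>k\<close>, so a
    single cubic polynomial serves the whole family.\<close>
  proof (rule exI[of _ "family_prog ws"], rule exI[of _ "monom C 3"], rule allI)
    fix k
    from C[of k] obtain t where t: "t \<le> C * (4 ^ k) ^ 3"
      "computes_in (family_prog ws) k (family_word k ws) t" by blast
    show "\<exists>w t. computes_in (family_prog ws) k w t \<and> t \<le> poly (monom C 3) (4 ^ k) \<and>
        matrices_code (4 ^ k) (length ws) (\<lambda>i. word_mat k (ws ! i)) w"
      using t code[of k] by (auto simp: poly_monom)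
  qed
qed

theorem corollary5p18:
  shows "\<exists>c :: real. c > 0 \<and> (\<forall>lam :: real. lam > 0 \<longrightarrow>
    (\<exists>(D :: nat) (\<delta> :: nat \<Rightarrow> real) (N :: nat \<Rightarrow> nat) (d :: nat \<Rightarrow> nat)
       (T :: nat \<Rightarrow> nat \<Rightarrow> complex mat).
      \<delta> \<longlonglongrightarrow> 0 \<and>
      strict_mono N \<and>
      (\<forall>k. d k \<le> D) \<and>
      (\<forall>k. \<forall>i<d k. T k i \<in> carrier_mat (N k) (N k)) \<and>
      explicit_family N d T \<and>
      (\<forall>k. vectorspace.dimension_expander class_ring (module_vec TYPE(complex) (N k))
             (d k) (\<lambda>i v. T k i *\<^sub>v v) (1 - lam - \<delta> (N k)) (1 / 2 - c * lam))))"
\<comment> \<open>The witnesses are \<open>c = 1\<close> and, further on, \<delta> = 0: once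
  \<open>t\<close> is fixed, the expansion bound has no error depending on the dimension.\<close>
proof (rule exI[of _ "1 :: real"], intro conjI allI impI)
  fix lam :: real assume lam: "lam > 0"
  have "(\<lambda>t. (1 - 1 / 5000 :: real) ^ t) \<longlonglongrightarrow> 0" by (rule LIMSEQ_power_zero) simp
  then have "\<forall>\<^sub>F t in sequentially. (1 - 1 / 5000 :: real) ^ t < lam / 4"
    using lam by (intro order_tendstoD) auto
  then obtain t where t: "(1 - 1 / 5000 :: real) ^ t \<le> lam / 4"
    by (auto simp: eventually_sequentially intro: less_imp_le)
  \<comment> \<open>There are \<open>5 ^ t\<close> words, and \<open>t\<close> was chosen from
    \<open>lam\<close> alone, so the number of maps is constant along the family.\<close>
  define ws where "ws = List.n_lists t gens"
  show "\<exists>(D :: nat) (\<delta> :: nat \<Rightarrow> real) (N :: nat \<Rightarrow> nat) (d :: nat \<Rightarrow> nat)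
       (T :: nat \<Rightarrow> nat \<Rightarrow> complex mat).
      \<delta> \<longlonglongrightarrow> 0 \<and>
      strict_mono N \<and>
      (\<forall>k. d k \<le> D) \<and>
      (\<forall>k. \<forall>i<d k. T k i \<in> carrier_mat (N k) (N k)) \<and>
      explicit_family N d T \<and>
      (\<forall>k. vectorspace.dimension_expander class_ring (module_vec TYPE(complex) (N k))
             (d k) (\<lambda>i v. T k i *\<^sub>v v) (1 - lam - \<delta> (N k)) (1 / 2 - 1 * lam))"
  proof (intro exI conjI allI impI)
    show "(\<lambda>_. 0 :: real) \<longlonglongrightarrow> 0" by simp
    show "strict_mono (\<lambda>k. 4 ^ k :: nat)" by (simp add: strict_mono_def)
    show "length ws \<le> length ws" by simp
    show "word_mat k (ws ! i) \<in> carrier_mat (4 ^ k) (4 ^ k)" for k i by (rule word_mat_carrier)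
    show "explicit_family (\<lambda>k. 4 ^ k) (\<lambda>_. length ws) (\<lambda>k i. word_mat k (ws ! i))"
      by (rule explicit_family_word_mat)
    show "vectorspace.dimension_expander class_ring (module_vec TYPE(complex) (4 ^ k))
        (length ws) (\<lambda>i v. word_mat k (ws ! i) *\<^sub>v v) (1 - lam - 0) (1 / 2 - 1 * lam)" for k
      using dimension_expander_word_mat[OF lam t, of k] by (simp add: ws_def)
  qed
qed simp

end
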